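(* Let $\beta\in\{1,2\}$ and let $(D_N)$ be real diagonal deterministic $N\times N$ matrices satisfying Assumptions 1 and 2 of the context, with limiting measure $\mu_D$. For any $0\le\theta<\theta_c$ we have $$\lim_{N\to\infty}\frac1N\log\left(\frac{\mathbb{E}_e\left[\mathbf{1}_{\|e\|_\infty\le N^{-3/8}}\,e^{N\theta\langle e,D_Ne\rangle}\right]}{I_N(D_N,\theta)}\right)=0.$$
   Context: For a compactly supported probability measure $\mu$ on $\mathbb{R}$, $\mathtt{l}(\mu)$ and $\mathtt{r}(\mu)$ are the left and right endpoints of its support, $G_\mu(y)=\int\frac{\mu(dt)}{y-t}$ for real $y$ outside $[\mathtt{l}(\mu),\mathtt{r}(\mu)]$, and $G_\mu(\mathtt{r}(\mu))=\lim_{y\downarrow\mathtt{r}(\mu)}G_\mu(y)\in(0,+\infty]$. For a self-adjoint matrix $M$, $\lambda_1(M)\le\dots\le\lambda_N(M)$ are its eigenvalues and $\hat\mu_M=\frac1N\sum_i\delta_{\lambda_i(M)}$. The distance on probability measures is $d(\mu,\nu)=\sup\{|\int f\,d(\mu-\nu)|:\sup_{x\ne y}\frac{|f(x)-f(y)|}{|x-y|}+\|f\|_{L^\infty}\le1\}$. Assumption 1. $D_N$ is real, diagonal and deterministic, $\hat\mu_{D_N}$ tends weakly to a compactly supported probability measure $\mu_D$, $\lambda_N(D_N)\to\mathtt{r}(\mu_D)$ and $\lambda_1(D_N)\to\mathtt{l}(\mu_D)$. Assumption 2. There exist $C>0$, $\epsilon_0>0$ with $d(\hat\mu_{D_N},\mu_D)\le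 CN^{-\epsilon_0}$. $\mathbb{E}_e$ denotes expectation over $e$ uniformly distributed on the unit sphere of $\mathbb{R}^N$ (if $\beta=1$) or of $\mathbb{C}^N$ (if $\beta=2$), $\|e\|_\infty=\max_i|e_i|$, and $I_N(X,\theta)=\mathbb{E}_e[e^{N\theta\langle e,Xe\rangle}]$ for self-adjoint $X$. The threshold is $\theta_c=\theta_c(\beta,\mu_D)=\frac\beta2G_{\mu_D}(\mathtt{r}(\mu_D))$ if $G_{\mu_D}(\mathtt{r}(\mu_D))<+\infty$, and $\theta_c=+\infty$ otherwise. *)

theory Defs
  imports "HOL-Probability.Probability" "Jordan_Normal_Form.Char_Poly"
begin

definition msupport :: "real measure \<Rightarrow> real set" where
  "msupport \<mu> = {x. \<forall>U. open U \<and> x \<in> U \<longrightarrow> emeasure \<mu> U > 0}"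

definition left_end :: "real measure \<Rightarrow> real" where
  "left_end \<mu> = Inf (msupport \<mu>)"

definition right_end :: "real measure \<Rightarrow> real" where
  "right_end \<mu> = Sup (msupport \<mu>)"

definition cauchy_transform :: "real measure \<Rightarrow> real \<Rightarrow> real" where
  "cauchy_transform \<mu> y = (LINT t|\<mu>. 1 / (y - t))"

definition G_right_end :: "real measure \<Rightarrow> ereal" where
  "G_right_end \<mu> = Lim (at_right (right_end \<mu>)) (\<lambda>y. ereal (cauchy_transform \<mu> y))"

definition theta_c :: "nat \<Rightarrow> real measure \<Rightarrow> ereal" where
  "theta_c \<beta> \<mu> = (if G_right_end \<mu> < \<infinity> then ereal (real \<beta> / 2) * G_right_end \<mu> else \<infinity>)"

text \<open>
  The eigenvalues of a self-adjoint matrix with multiplicity, in nondecreasing order. As is usual,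
  they are numbered from 1, whereas list positions start at 0.
\<close>
definition eigs :: "complex mat \<Rightarrow> real list" where
  "eigs M = (THE as. sorted as \<and> char_poly M = (\<Prod>a\<leftarrow>as. [:- complex_of_real a, 1:]))"

definition eigval :: "complex mat \<Rightarrow> nat \<Rightarrow> real" where
  "eigval M i = eigs M ! (i - 1)"

definition emp_measure :: "complex mat \<Rightarrow> real measure" where
  "emp_measure M = distr (uniform_count_measure {1..dim_row M}) borel (eigval M)"

text \<open>
  The norm is computed in the extended reals, so that it is infinite, rather than an
  unspecified real number, for functions that are unbounded or not Lipschitz.
\<close>
definition BL_norm :: "(real \<Rightarrow> real) \<Rightarrow> ereal" where
  "BL_norm f = (SUP (x, y)\<in>{(x, y). x \<noteq> y}. ereal (\<bar>f x - f y\<bar> / \<bar>x - y\<bar>)) + (SUP x. ereal \<bar>f x\<bar>)"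

text \<open>
  For probability measures, the supremum is taken over a nonempty set bounded by 2.
\<close>
definition BL_dist :: "real measure \<Rightarrow> real measure \<Rightarrow> real" where
  "BL_dist \<mu> \<nu> = (SUP f\<in>{f. BL_norm f \<le> 1}. \<bar>(LINT x|\<mu>. f x) - (LINT x|\<nu>. f x)\<bar>)"

text \<open>
  The normalised surface measure of the unit sphere of \<open>'a\<^sup>N\<close>, for \<open>'a\<close> either \<open>real\<close> or \<open>complex\<close>:
  the measure of a set \<open>A\<close> of unit vectors is the share of the volume of the unit ball that is
  taken by the cone over \<open>A\<close>. Vectors are functions on \<open>{..<N}\<close>.
\<close>
definition unif_sphere :: "nat \<Rightarrow> (nat \<Rightarrow> 'a::euclidean_space) measure" where
  "unif_sphere N =
     distr (uniform_measure (\<Pi>\<^sub>M i\<in>{..<N}. lborel)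
              {x \<in> space (\<Pi>\<^sub>M i\<in>{..<N}. lborel). L2_set (\<lambda>i. norm (x i)) {..<N} \<le> 1})
       (\<Pi>\<^sub>M i\<in>{..<N}. borel)
       (\<lambda>x. \<lambda>i\<in>{..<N}. x i /\<^sub>R L2_set (\<lambda>i. norm (x i)) {..<N})"

text \<open>
  The law of \<open>e\<close>. To treat both values of \<open>\<beta>\<close> at once, the unit sphere of \<open>\<real>\<^sup>N\<close> (\<open>\<beta> = 1\<close>)
  is embedded into that of \<open>\<complex>\<^sup>N\<close> (\<open>\<beta> = 2\<close>).
\<close>
definition sphere_law :: "nat \<Rightarrow> nat \<Rightarrow> (nat \<Rightarrow> complex) measure" where
  "sphere_law \<beta> N =
     (if \<beta> = 1
      then distr (unif_sphere N) (\<Pi>\<^sub>M i\<in>{..<N}. borel) (\<lambda>x. \<lambda>i\<in>{..<N}. complex_of_real (x i))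
      else unif_sphere N)"

definition sup_norm :: "nat \<Rightarrow> (nat \<Rightarrow> complex) \<Rightarrow> real" where
  "sup_norm N e = (MAX i\<in>{..<N}. cmod (e i))"

text \<open>\<open>\<langle>e, X e\<rangle>\<close>, which is a real number when \<open>X\<close> is self-adjoint.\<close>
definition quad_form :: "complex mat \<Rightarrow> (nat \<Rightarrow> complex) \<Rightarrow> real" where
  "quad_form X e = (let v = Matrix.vec (dim_row X) e in Re ((X *\<^sub>v v) \<bullet>c v))"

definition I_sph :: "nat \<Rightarrow> nat \<Rightarrow> complex mat \<Rightarrow> real \<Rightarrow> real" where
  "I_sph \<beta> N X \<theta> = (LINT e|sphere_law \<beta> N. exp (real N * \<theta> * quad_form X e))"

definition I_sph_deloc :: "nat \<Rightarrow> nat \<Rightarrow> complex mat \<Rightarrow> real \<Rightarrow> real" where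
  "I_sph_deloc \<beta> N X \<theta> =
     (LINT e|sphere_law \<beta> N. indicator {e. sup_norm N e \<le> real N powr (- 3 / 8)} e *
        exp (real N * \<theta> * quad_form X e))"

end

theory Submission
  imports Defs "HOL-Real_Asymp.Real_Asymp"
begin

text \<open>
  The weight \<open>F e = exp (N \<theta> \<langle>e, D e\<rangle>)\<close> and the delocalisation event depend only on the direction of a
  vector, so their integrals over the unit ball are, up to a common constant, integrals over the shell
  \<open>1 - \<delta> < \<bar>x\<bar>\<^sup>2 \<le> 1 + \<delta>\<close>. There, for every real \<open>w\<close>, \<open>F\<close> equals the Gaussian weight
  \<open>exp (N w - N \<Sum>\<^sub>i (w - \<theta> d\<^sub>i) \<bar>x\<^sub>i\<bar>\<^sup>2)\<close> up to a factor \<open>exp (\<plusminus> N L \<delta>)\<close>. As \<open>\<theta> < \<theta>\<^sub>c\<close>, one can take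
  \<open>w = \<theta> v\<close> with \<open>v\<close> to the right of the support and \<open>(\<beta> / 2) G(v) = \<theta>\<close> (and \<open>w = \<beta> / 2\<close> if \<open>\<theta> = 0\<close>); then the mean of \<open>\<bar>x\<bar>\<^sup>2\<close> under
  the Gaussian law tends to 1 and the variances of the coordinates are of order \<open>1 / N\<close>. By exponential
  Markov bounds this law gives mass at least 1/2 to the delocalised vectors of the shell. So the ratio is
  at least \<open>exp (- 2 N L \<delta>) / 2\<close> eventually, for every \<open>\<delta> > 0\<close>.
\<close>

section \<open>Gaussian integrals on product spaces\<close>

lemma nn_integral_gaussian_real:
  fixes c :: real
  assumes "0 < c"
  shows "(\<integral>\<^sup>+x. ennreal (exp (- c * x\<^sup>2)) \<partial>lborel) = ennreal (sqrt (pi / c))"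
proof -
  define s where "s = sqrt (1 / (2 * c))"
  have s: "s > 0" "2 * s\<^sup>2 = 1 / c" using assms by (simp_all add: s_def)
  have "exp (- c * x\<^sup>2) = sqrt (pi / c) * normal_density 0 s x" for x
  proof -
    have "2 * pi * s\<^sup>2 = pi / c" using s(2) by (simp add: field_simps)
    moreover have "- (x\<^sup>2) / (2 * s\<^sup>2) = - c * x\<^sup>2" using s(2) assms by simp
    ultimately show ?thesis using assms by (simp add: normal_density_def)
  qed
  then have "(\<integral>\<^sup>+x. ennreal (exp (- c * x\<^sup>2)) \<partial>lborel) =
      (\<integral>\<^sup>+x. ennreal (sqrt (pi / c)) * ennreal (normal_density 0 s x) \<partial>lborel)"
    using assms by (intro nn_integral_cong) (simp add: ennreal_mult[symmetric])
  also have "\<dots> = ennreal (sqrt (pi / c)) * (\<integral>\<^sup>+x. ennreal (normal_density 0 s x) \<partial>lborel)"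
    by (intro nn_integral_cmult) auto
  also have "(\<integral>\<^sup>+x. ennreal (normal_density 0 s x) \<partial>lborel) = 1"
    using prob_space.emeasure_space_1[OF prob_space_normal_density[OF s(1), of 0]]
    by (simp add: emeasure_density)
  finally show ?thesis by simp
qed

text \<open>The squared norm is a sum over an orthonormal basis, so the integral factorises.
  Throughout, \<open>DIM('a)\<close> stands for \<beta>: it is 1 for \<open>real\<close> and 2 for
  \<open>complex\<close>, which treats both spheres at once.\<close>

lemma nn_integral_gaussian:
  fixes c :: real
  assumes "0 < c"
  shows "(\<integral>\<^sup>+x. ennreal (exp (- c * (norm x)\<^sup>2)) \<partial>(lborel::'a::euclidean_space measure)) =
    ennreal (sqrt (pi / c) ^ DIM('a))"
proof -
  have "(norm x)\<^sup>2 = (\<Sum>b\<in>Basis. (x \<bullet> b)\<^sup>2)" for x :: 'a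
    unfolding power2_norm_eq_inner by (subst euclidean_inner) (simp add: power2_eq_square)
  then have "exp (- c * (norm x)\<^sup>2) = (\<Prod>b\<in>Basis. exp (- c * (x \<bullet> b)\<^sup>2))" for x :: 'a
    by (simp add: exp_sum[symmetric] sum_distrib_left sum_negf)
  then have "(\<integral>\<^sup>+x. ennreal (exp (- c * (norm x)\<^sup>2)) \<partial>(lborel::'a measure)) =
      (\<integral>\<^sup>+x. (\<Prod>b\<in>Basis. ennreal (exp (- c * (x \<bullet> b)\<^sup>2))) \<partial>(lborel::'a measure))"
    by (simp add: prod_ennreal)
  also have "\<dots> = (\<Prod>b\<in>(Basis::'a set). ennreal (sqrt (pi / c)))"
    using nn_integral_gaussian_real[OF assms] by (subst nn_integral_lborel_prod) auto
  finally show ?thesis using assms by (simp add: ennreal_power)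
qed

abbreviation lebesgue_prod :: "nat \<Rightarrow> (nat \<Rightarrow> 'a::euclidean_space) measure" where
  "lebesgue_prod N \<equiv> (\<Pi>\<^sub>M i\<in>{..<N}. lborel)"

interpretation lborel_product: product_sigma_finite "\<lambda>i::nat. lborel :: 'a::euclidean_space measure"
  by standard

lemma nn_integral_gaussian_prod:
  fixes a :: "nat \<Rightarrow> real"
  assumes "\<And>i. i < N \<Longrightarrow> 0 < a i"
  shows "(\<integral>\<^sup>+x. ennreal (exp (- (\<Sum>i<N. a i * (norm (x i))\<^sup>2))) \<partial>(lebesgue_prod N :: (nat \<Rightarrow> 'a::euclidean_space) measure)) =
    ennreal (\<Prod>i<N. sqrt (pi / a i) ^ DIM('a))"
proof -
  have "(\<integral>\<^sup>+x. ennreal (exp (- (\<Sum>i<N. a i * (norm (x i))\<^sup>2))) \<partial>(lebesgue_prod N :: (nat \<Rightarrow> 'a) measure)) =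
      (\<integral>\<^sup>+x. (\<Prod>i<N. ennreal (exp (- a i * (norm (x i))\<^sup>2))) \<partial>(lebesgue_prod N :: (nat \<Rightarrow> 'a) measure))"
    by (simp add: prod_ennreal exp_sum[symmetric] sum_negf)
  also have "\<dots> = (\<Prod>i<N. ennreal (sqrt (pi / a i) ^ DIM('a)))"
    using nn_integral_gaussian[where 'a='a] assms
    by (subst lborel_product.product_nn_integral_prod) auto
  also have "\<dots> = ennreal (\<Prod>i<N. sqrt (pi / a i) ^ DIM('a))"
    using assms by (subst prod_ennreal) (auto simp: less_imp_le)
  finally show ?thesis .
qed

text \<open>Change of variables for a dilation. Pushing Lebesgue measure forward and multiplying by
  the Jacobian changes no box, and boxes determine a product measure.\<close>

lemma nn_integral_scale_prod:
  fixes f :: "(nat \<Rightarrow> 'a::euclidean_space) \<Rightarrow> ennreal"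
  assumes R: "0 < R" and f[measurable]: "f \<in> borel_measurable (lebesgue_prod N)"
  shows "(\<integral>\<^sup>+x. f x \<partial>lebesgue_prod N) =
    ennreal (R ^ (DIM('a) * N)) * (\<integral>\<^sup>+x. f (\<lambda>i\<in>{..<N}. R *\<^sub>R x i) \<partial>lebesgue_prod N)"
proof -
  let ?M = "lebesgue_prod N :: (nat \<Rightarrow> 'a) measure"
  let ?T = "\<lambda>x::nat \<Rightarrow> 'a. \<lambda>i\<in>{..<N}. R *\<^sub>R x i"
  let ?c = "ennreal (R ^ (DIM('a) * N))"
  have T[measurable]: "?T \<in> measurable ?M ?M" by measurable
  \<comment> \<open>The one-dimensional factor of the Jacobian; the boxes below multiply
    \<open>N\<close> of these identities.\<close>
  have scale1: "ennreal (R ^ DIM('a)) * emeasure lborel ((\<lambda>x. R *\<^sub>R x) -` A) = emeasure lborel A"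
    if "A \<in> sets lborel" for A :: "'a set"
  proof -
    have "emeasure (lborel :: 'a measure) A =
        emeasure (density (distr lborel borel (\<lambda>x. 0 + R *\<^sub>R x)) (\<lambda>_. \<bar>R\<bar> ^ DIM('a))) A"
      using R lborel_affine[of R "0::'a"] by simp
    also have "\<dots> = ennreal (R ^ DIM('a)) * emeasure (distr lborel borel (\<lambda>x. 0 + R *\<^sub>R x)) A"
      using that R by (subst emeasure_density) (auto simp: nn_integral_cmult)
    finally show ?thesis using that by (simp add: emeasure_distr)
  qed
  have "density (distr ?M ?M ?T) (\<lambda>_. ?c) = ?M"
  proof (rule lborel_product.PiM_eqI)
    fix A :: "nat \<Rightarrow> 'a set" assume A: "\<And>i. i \<in> {..<N} \<Longrightarrow> A i \<in> sets lborel"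
    have PA[measurable]: "Pi\<^sub>E {..<N} A \<in> sets ?M" using A by (intro sets_PiM_I_finite) auto
    have pre: "(\<lambda>x. R *\<^sub>R x) -` A i \<in> sets lborel" if "i < N" for i
      using measurable_sets[of "\<lambda>x. R *\<^sub>R x" lborel lborel "A i"] A that by auto
    have "emeasure (density (distr ?M ?M ?T) (\<lambda>_. ?c)) (Pi\<^sub>E {..<N} A) =
        ?c * emeasure ?M (?T -` Pi\<^sub>E {..<N} A \<inter> space ?M)"
      by (subst emeasure_density) (auto simp: nn_integral_cmult emeasure_distr)
    also have "?T -` Pi\<^sub>E {..<N} A \<inter> space ?M = Pi\<^sub>E {..<N} (\<lambda>i. (\<lambda>x. R *\<^sub>R x) -` A i)"
      by (auto simp: space_PiM PiE_iff)
    also have "emeasure ?M \<dots> = (\<Prod>i<N. emeasure lborel ((\<lambda>x. R *\<^sub>R x) -` A i))"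
      using pre by (subst lborel_product.emeasure_PiM) auto
    also have "?c * \<dots> = (\<Prod>i<N. ennreal (R ^ DIM('a)) * emeasure lborel ((\<lambda>x. R *\<^sub>R x) -` A i))"
      using R by (simp add: prod.distrib power_mult ennreal_power[symmetric])
    also have "\<dots> = (\<Prod>i<N. emeasure lborel (A i))"
      using A by (intro prod.cong scale1) auto
    finally show "emeasure (density (distr ?M ?M ?T) (\<lambda>_. ?c)) (Pi\<^sub>E {..<N} A) =
        (\<Prod>i<N. emeasure lborel (A i))" .
  qed auto
  then have "(\<integral>\<^sup>+x. f x \<partial>?M) = (\<integral>\<^sup>+x. f x \<partial>density (distr ?M ?M ?T) (\<lambda>_. ?c))" by simp
  also have "\<dots> = ?c * (\<integral>\<^sup>+x. f (?T x) \<partial>?M)"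
    by (simp add: nn_integral_density nn_integral_cmult nn_integral_distr)
  finally show ?thesis .
qed

section \<open>Exponential tilting of Gaussian weights\<close>

text \<open>Second-order bound on \<open>ln (1 - u)\<close>, valid for both signs of
  \<open>u\<close>. The linear term is exact, so that the mean of the Gaussian law later enters
  without loss.\<close>

lemma inverse_one_minus_le_exp:
  fixes u :: real
  assumes "\<bar>u\<bar> \<le> 1 / 2"
  shows "1 / (1 - u) \<le> exp (u + 2 * u\<^sup>2)"
proof -
  have "\<bar>ln (1 + (- u)) - (- u)\<bar> \<le> 2 * (- u)\<^sup>2"
    using assms by (intro abs_ln_one_plus_x_minus_x_bound) auto
  then have "- (u + 2 * u\<^sup>2) \<le> ln (1 - u)" by simp
  then have "exp (- (u + 2 * u\<^sup>2)) \<le> 1 - u"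
    using assms by (subst (asm) ln_ge_iff) auto
  then have "inverse (1 - u) \<le> inverse (exp (- (u + 2 * u\<^sup>2)))"
    by (rule le_imp_inverse_le) simp
  then show ?thesis by (simp only: exp_minus[of "u + 2 * u\<^sup>2"] inverse_inverse_eq inverse_eq_divide[symmetric])
qed

text \<open>Bounds the Laplace transform of \<Sum> \<open>h i * |x i|^2\<close> under the Gaussian
  law with coefficients \<open>a\<close>: passing from \<open>a i\<close> to
  \<open>a i - h i\<close> multiplies the i-th factor by the power \<open>n / 2\<close> of
  \<open>1 / (1 - h i / a i)\<close>. The linear term of the exponent is the mean, the squares are
  the error.\<close>

lemma gaussian_tilt:
  fixes a h :: "nat \<Rightarrow> real"
  assumes a: "\<And>i. i < N \<Longrightarrow> 0 < a i" and h: "\<And>i. i < N \<Longrightarrow> \<bar>h i / a i\<bar> \<le> 1 / 2"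
  shows "(\<Prod>i<N. sqrt (pi / (a i - h i)) ^ n) \<le>
    exp (real n / 2 * (\<Sum>i<N. h i / a i + 2 * (h i / a i)\<^sup>2)) * (\<Prod>i<N. sqrt (pi / a i) ^ n)"
proof -
  have "sqrt (pi / (a i - h i)) ^ n \<le> exp (real n / 2 * (h i / a i + 2 * (h i / a i)\<^sup>2)) * sqrt (pi / a i) ^ n"
    if i: "i < N" for i
  proof -
    let ?u = "h i / a i"
    have "pi / (a i - h i) = pi / a i * (1 / (1 - ?u))"
      using a[OF i] by (simp add: field_simps)
    also have "\<dots> \<le> pi / a i * exp (?u + 2 * ?u\<^sup>2)"
      using a[OF i] h[OF i] by (intro mult_left_mono inverse_one_minus_le_exp) auto
    also have "\<dots> = pi / a i * (exp ((?u + 2 * ?u\<^sup>2) / 2))\<^sup>2"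
      by (simp add: exp_double[symmetric])
    finally have "sqrt (pi / (a i - h i)) \<le> sqrt (pi / a i * (exp ((?u + 2 * ?u\<^sup>2) / 2))\<^sup>2)"
      by (rule real_sqrt_le_mono)
    also have "\<dots> = sqrt (pi / a i) * exp ((?u + 2 * ?u\<^sup>2) / 2)"
      by (simp only: real_sqrt_mult real_sqrt_abs abs_exp_cancel)
    finally have le: "sqrt (pi / (a i - h i)) \<le> sqrt (pi / a i) * exp ((?u + 2 * ?u\<^sup>2) / 2)" .
    have "h i \<le> a i / 2" using h[OF i] a[OF i] by (simp add: abs_le_iff field_simps)
    then have "0 \<le> sqrt (pi / (a i - h i))" using a[OF i] by simp
    from power_mono[OF le this, of n] show ?thesis
      by (simp add: power_mult_distrib exp_of_nat_mult[symmetric] mult_ac)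
  qed
  moreover have "0 \<le> sqrt (pi / (a i - h i)) ^ n" if i: "i < N" for i
  proof -
    have "h i \<le> a i / 2" using h[OF i] a[OF i] by (simp add: abs_le_iff field_simps)
    then show ?thesis using a[OF i] by simp
  qed
  ultimately have "(\<Prod>i<N. sqrt (pi / (a i - h i)) ^ n) \<le>
      (\<Prod>i<N. exp (real n / 2 * (h i / a i + 2 * (h i / a i)\<^sup>2)) * sqrt (pi / a i) ^ n)"
    by (intro prod_mono) auto
  then show ?thesis by (simp add: prod.distrib exp_sum[symmetric] sum_distrib_left)
qed

text \<open>Exponential Markov inequality: the tilted weight is again Gaussian, with \<open>a - h\<close> in place of \<open>a\<close>.\<close>

lemma gaussian_markov:
  fixes a h :: "nat \<Rightarrow> real" and A :: "(nat \<Rightarrow> 'a::euclidean_space) set"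
  assumes a: "\<And>i. i < N \<Longrightarrow> 0 < a i" and h: "\<And>i. i < N \<Longrightarrow> \<bar>h i / a i\<bar> \<le> 1 / 2"
    and A: "\<And>x. x \<in> A \<Longrightarrow> \<kappa> \<le> (\<Sum>i<N. h i * (norm (x i))\<^sup>2)"
  shows "(\<integral>\<^sup>+x. ennreal (exp (- (\<Sum>i<N. a i * (norm (x i))\<^sup>2))) * indicator A x \<partial>lebesgue_prod N) \<le>
    ennreal (exp (real DIM('a) / 2 * (\<Sum>i<N. h i / a i + 2 * (h i / a i)\<^sup>2) - \<kappa>) *
      (\<Prod>i<N. sqrt (pi / a i) ^ DIM('a)))"
proof -
  let ?M = "lebesgue_prod N :: (nat \<Rightarrow> 'a) measure"
  have pos: "0 < a i - h i" if "i < N" for i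
    using a[OF that] h[OF that] by (simp add: abs_le_iff field_simps)
  have "(\<integral>\<^sup>+x. ennreal (exp (- (\<Sum>i<N. a i * (norm (x i))\<^sup>2))) * indicator A x \<partial>?M) \<le>
      (\<integral>\<^sup>+x. ennreal (exp (- \<kappa>)) * ennreal (exp (- (\<Sum>i<N. (a i - h i) * (norm (x i))\<^sup>2))) \<partial>?M)"
  proof (intro nn_integral_mono)
    fix x :: "nat \<Rightarrow> 'a"
    have "- (\<Sum>i<N. a i * (norm (x i))\<^sup>2) \<le> - \<kappa> - (\<Sum>i<N. (a i - h i) * (norm (x i))\<^sup>2)" if "x \<in> A"
      using A[OF that] by (simp add: left_diff_distrib sum_subtractf)
    then have "exp (- (\<Sum>i<N. a i * (norm (x i))\<^sup>2)) \<le>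
        exp (- \<kappa>) * exp (- (\<Sum>i<N. (a i - h i) * (norm (x i))\<^sup>2))" if "x \<in> A"
      using that by (simp add: exp_add[symmetric])
    then show "ennreal (exp (- (\<Sum>i<N. a i * (norm (x i))\<^sup>2))) * indicator A x \<le>
        ennreal (exp (- \<kappa>)) * ennreal (exp (- (\<Sum>i<N. (a i - h i) * (norm (x i))\<^sup>2)))"
      by (simp add: ennreal_mult[symmetric] split: split_indicator)
  qed
  also have "\<dots> = ennreal (exp (- \<kappa>)) * ennreal (\<Prod>i<N. sqrt (pi / (a i - h i)) ^ DIM('a))"
    using pos by (subst nn_integral_cmult) (simp_all add: nn_integral_gaussian_prod)
  also have "\<dots> = ennreal (exp (- \<kappa>) * (\<Prod>i<N. sqrt (pi / (a i - h i)) ^ DIM('a)))"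
    using pos by (intro ennreal_mult[symmetric] prod_nonneg) (auto simp: less_imp_le)
  also have "\<dots> \<le> ennreal (exp (- \<kappa>) * (exp (real DIM('a) / 2 * (\<Sum>i<N. h i / a i + 2 * (h i / a i)\<^sup>2)) *
      (\<Prod>i<N. sqrt (pi / a i) ^ DIM('a))))"
    using gaussian_tilt[of N a h "DIM('a)"] a h by (intro ennreal_leI mult_left_mono) auto
  finally show ?thesis by (simp only: diff_conv_add_uminus exp_add mult_ac)
qed

section \<open>Radial integration\<close>

text \<open>The zero vector is normalised to itself, so scaling invariance has no exception.\<close>

definition normalised :: "nat \<Rightarrow> (nat \<Rightarrow> 'a::euclidean_space) \<Rightarrow> nat \<Rightarrow> 'a" where
  "normalised N x = (\<lambda>i\<in>{..<N}. x i /\<^sub>R L2_set (\<lambda>i. norm (x i)) {..<N})"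

lemma measurable_L2_set[measurable]:
  "(\<lambda>x. L2_set (\<lambda>i. norm (x i)) {..<N}) \<in> borel_measurable (lebesgue_prod N)"
  unfolding L2_set_def by measurable

lemma measurable_normalised[measurable]:
  "normalised N \<in> measurable (lebesgue_prod N) (\<Pi>\<^sub>M i\<in>{..<N}. borel)"
  unfolding normalised_def by measurable

lemma L2_set_scale:
  "0 < R \<Longrightarrow> L2_set (\<lambda>i. norm ((\<lambda>i\<in>{..<N}. R *\<^sub>R x i) i)) {..<N} = R * L2_set (\<lambda>i. norm (x i)) {..<N}"
  by (subst L2_set_cong[OF refl, where g = "\<lambda>i. R * norm (x i)"]) (auto simp: L2_set_right_distrib)

lemma normalised_scale:
  assumes "0 < R"
  shows "normalised N (\<lambda>i\<in>{..<N}. R *\<^sub>R x i) = normalised N x"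
  unfolding normalised_def L2_set_scale[OF assms] using assms by (intro restrict_ext) simp

abbreviation unit_ball :: "nat \<Rightarrow> (nat \<Rightarrow> 'a::euclidean_space) set" where
  "unit_ball N \<equiv> {x \<in> space (lebesgue_prod N). L2_set (\<lambda>i. norm (x i)) {..<N} \<le> 1}"

lemma nn_integral_unif_sphere:
  fixes f :: "(nat \<Rightarrow> 'a::euclidean_space) \<Rightarrow> ennreal"
  assumes [measurable]: "f \<in> borel_measurable (\<Pi>\<^sub>M i\<in>{..<N}. borel)"
  shows "(\<integral>\<^sup>+e. f e \<partial>unif_sphere N) =
    (\<integral>\<^sup>+x. f (normalised N x) * indicator (unit_ball N) x \<partial>lebesgue_prod N) /
      emeasure (lebesgue_prod N) (unit_ball N :: (nat \<Rightarrow> 'a) set)"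
proof -
  have "(\<integral>\<^sup>+e. f e \<partial>unif_sphere N) =
      (\<integral>\<^sup>+x. f (normalised N x) \<partial>uniform_measure (lebesgue_prod N) (unit_ball N))"
    unfolding unif_sphere_def by (subst nn_integral_distr) (auto simp: normalised_def)
  then show ?thesis by (simp add: nn_integral_uniform_measure)
qed

text \<open>The integrand is constant along rays, so only the volume element sees the
  dilation.\<close>

lemma nn_integral_ball_scale:
  fixes f :: "(nat \<Rightarrow> 'a::euclidean_space) \<Rightarrow> ennreal"
  assumes [measurable]: "f \<in> borel_measurable (\<Pi>\<^sub>M i\<in>{..<N}. borel)" and R: "0 < R"
  shows "(\<integral>\<^sup>+x. f (normalised N x) * indicator {x. L2_set (\<lambda>i. norm (x i)) {..<N} \<le> R} x \<partial>lebesgue_prod N) =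
    ennreal (R ^ (DIM('a) * N)) *
      (\<integral>\<^sup>+x. f (normalised N x) * indicator (unit_ball N) x \<partial>lebesgue_prod N)"
proof -
  \<comment> \<open>The indicator becomes a condition on the norm, so that the scaling rules can
    rewrite it.\<close>
  have "(\<integral>\<^sup>+x. f (normalised N x) * indicator {x. L2_set (\<lambda>i. norm (x i)) {..<N} \<le> R} x \<partial>lebesgue_prod N) =
      (\<integral>\<^sup>+x. f (normalised N x) * (if L2_set (\<lambda>i. norm (x i)) {..<N} \<le> R then 1 else 0) \<partial>lebesgue_prod N)"
    by (intro nn_integral_cong) (auto split: split_indicator)
  also have "\<dots> = ennreal (R ^ (DIM('a) * N)) * (\<integral>\<^sup>+x. f (normalised N x) *
      (if R * L2_set (\<lambda>i. norm (x i)) {..<N} \<le> R then 1 else 0) \<partial>lebesgue_prod N)"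
    by (subst nn_integral_scale_prod[OF R]) (simp_all only: L2_set_scale[OF R] normalised_scale[OF R], measurable)
  also have "(\<integral>\<^sup>+x. f (normalised N x) *
      (if R * L2_set (\<lambda>i. norm (x i)) {..<N} \<le> R then 1 else 0) \<partial>lebesgue_prod N) =
      (\<integral>\<^sup>+x. f (normalised N x) * indicator (unit_ball N) x \<partial>lebesgue_prod N)"
    using R by (intro nn_integral_cong) (auto split: split_indicator)
  finally show ?thesis .
qed

text \<open>A shell is the difference of two balls. Finiteness of the integral over the unit ball is
  what permits the cancellation in the extended nonnegative reals.\<close>

lemma nn_integral_shell:
  fixes f :: "(nat \<Rightarrow> 'a::euclidean_space) \<Rightarrow> ennreal"
  assumes [measurable]: "f \<in> borel_measurable (\<Pi>\<^sub>M i\<in>{..<N}. borel)" and ab: "0 < a" "a \<le> b"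
    and fin: "(\<integral>\<^sup>+x. f (normalised N x) * indicator (unit_ball N) x \<partial>lebesgue_prod N) < \<infinity>"
  shows "(\<integral>\<^sup>+x. f (normalised N x) * indicator {x. L2_set (\<lambda>i. norm (x i)) {..<N} \<in> {a<..b}} x \<partial>lebesgue_prod N) =
    ennreal (b ^ (DIM('a) * N) - a ^ (DIM('a) * N)) *
      (\<integral>\<^sup>+x. f (normalised N x) * indicator (unit_ball N) x \<partial>lebesgue_prod N)"
proof -
  let ?r = "\<lambda>x::nat \<Rightarrow> 'a. L2_set (\<lambda>i. norm (x i)) {..<N}"
  let ?J = "\<integral>\<^sup>+x. f (normalised N x) * indicator (unit_ball N) x \<partial>lebesgue_prod N"
  let ?S = "\<integral>\<^sup>+x. f (normalised N x) * indicator {x. ?r x \<in> {a<..b}} x \<partial>lebesgue_prod N"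
  let ?m = "DIM('a) * N"
  have "ennreal (b ^ ?m) * ?J = (\<integral>\<^sup>+x. f (normalised N x) * indicator {x. ?r x \<le> b} x \<partial>lebesgue_prod N)"
    using ab by (subst nn_integral_ball_scale) auto
  also have "\<dots> = (\<integral>\<^sup>+x. f (normalised N x) * indicator {x \<in> space (lebesgue_prod N). ?r x \<le> a} x +
      f (normalised N x) * indicator {x \<in> space (lebesgue_prod N). ?r x \<in> {a<..b}} x \<partial>lebesgue_prod N)"
    using ab by (intro nn_integral_cong) (auto split: split_indicator)
  also have "\<dots> = (\<integral>\<^sup>+x. f (normalised N x) * indicator {x \<in> space (lebesgue_prod N). ?r x \<le> a} x \<partial>lebesgue_prod N) +
      (\<integral>\<^sup>+x. f (normalised N x) * indicator {x \<in> space (lebesgue_prod N). ?r x \<in> {a<..b}} x \<partial>lebesgue_prod N)"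
    by (subst nn_integral_add) (auto simp: greaterThanAtMost_iff)
  also have "(\<integral>\<^sup>+x. f (normalised N x) * indicator {x \<in> space (lebesgue_prod N). ?r x \<le> a} x \<partial>lebesgue_prod N) =
      (\<integral>\<^sup>+x. f (normalised N x) * indicator {x. ?r x \<le> a} x \<partial>lebesgue_prod N)"
    by (intro nn_integral_cong) (auto split: split_indicator)
  also have "\<dots> = ennreal (a ^ ?m) * ?J" using ab by (intro nn_integral_ball_scale) auto
  also have "(\<integral>\<^sup>+x. f (normalised N x) * indicator {x \<in> space (lebesgue_prod N). ?r x \<in> {a<..b}} x \<partial>lebesgue_prod N) = ?S"
    by (intro nn_integral_cong) (auto split: split_indicator)
  finally have eq: "ennreal (b ^ ?m) * ?J = ennreal (a ^ ?m) * ?J + ?S" .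
  have "a ^ ?m \<le> b ^ ?m" using ab by (intro power_mono) auto
  then have "ennreal (b ^ ?m) = ennreal (a ^ ?m) + ennreal (b ^ ?m - a ^ ?m)"
    using ab by (simp add: ennreal_plus[symmetric] del: ennreal_plus)
  then have "ennreal (a ^ ?m) * ?J + ennreal (b ^ ?m - a ^ ?m) * ?J = ennreal (a ^ ?m) * ?J + ?S"
    using eq by (simp add: distrib_right)
  moreover have "ennreal (a ^ ?m) * ?J \<noteq> \<infinity>" using fin by (simp add: ennreal_mult_eq_top_iff)
  ultimately show ?thesis by (simp add: ennreal_add_left_cancel)
qed

section \<open>Comparison of the sphere with the Gaussian law\<close>

text \<open>Linearity in the shape of the union bound: \<open>p\<close> will indicate the good set,
  \<open>b1\<close> and \<open>b2\<close> a radius outside the shell, and \<open>b i\<close> a large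
  i-th coordinate.\<close>

lemma nn_integral_mult_cover:
  fixes g p b1 b2 :: "'b \<Rightarrow> ennreal"
  assumes [measurable]: "g \<in> borel_measurable M" "p \<in> borel_measurable M"
    "b1 \<in> borel_measurable M" "b2 \<in> borel_measurable M" "\<And>i. i \<in> I \<Longrightarrow> b i \<in> borel_measurable M"
  shows "(\<integral>\<^sup>+x. g x * (p x + (b1 x + b2 x + (\<Sum>i\<in>I. b i x))) \<partial>M) =
    (\<integral>\<^sup>+x. g x * p x \<partial>M) + ((\<integral>\<^sup>+x. g x * b1 x \<partial>M) + (\<integral>\<^sup>+x. g x * b2 x \<partial>M) +
      (\<Sum>i\<in>I. \<integral>\<^sup>+x. g x * b i x \<partial>M))"
  by (simp add: distrib_left sum_distrib_left nn_integral_add nn_integral_sum)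

text \<open>On the shell the spherical and the Gaussian weight agree up to
  \<open>exp (N * L * \<delta>)\<close> either way, with
  \<open>L = \<theta> * K + \<bar>w\<bar>\<close>. Hence the whole shell integral is at most that
  factor times the full Gaussian mass, while the delocalised part is at least its inverse times the
  half of the mass left by \<open>bad\<close>. Both estimates carry the same
  \<open>exp (N * w)\<close>, and the volumes of shell and ball cancel.\<close>

lemma sphere_ratio:
  fixes d :: "nat \<Rightarrow> real" and t \<delta> K w \<theta> :: real
  assumes N: "1 \<le> N" and \<delta>: "0 < \<delta>" "\<delta> < 1" and \<theta>: "0 \<le> \<theta>"
    and K: "\<And>i. i < N \<Longrightarrow> \<bar>d i\<bar> \<le> K" and c: "\<And>i. i < N \<Longrightarrow> 0 < w - \<theta> * d i" and t: "0 < t"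
  defines "g \<equiv> \<lambda>x::nat \<Rightarrow> 'a::euclidean_space. ennreal (exp (- (\<Sum>i<N. real N * (w - \<theta> * d i) * (norm (x i))\<^sup>2)))"
    and "Z \<equiv> \<Prod>i<N. sqrt (pi / (real N * (w - \<theta> * d i))) ^ DIM('a)"
    and "F \<equiv> \<lambda>e::nat \<Rightarrow> 'a. exp (real N * \<theta> * (\<Sum>i<N. d i * (norm (e i))\<^sup>2))"
  assumes bad: "(\<integral>\<^sup>+x. g x * indicator {x. (\<Sum>i<N. (norm (x i))\<^sup>2) \<le> 1 - \<delta>} x \<partial>lebesgue_prod N) +
      (\<integral>\<^sup>+x. g x * indicator {x. 1 + \<delta> \<le> (\<Sum>i<N. (norm (x i))\<^sup>2)} x \<partial>lebesgue_prod N) +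
      (\<Sum>i<N. \<integral>\<^sup>+x. g x * indicator {x. t\<^sup>2 * (1 - \<delta>) \<le> (norm (x i))\<^sup>2} x \<partial>lebesgue_prod N) \<le> ennreal (Z / 2)"
  shows "(\<integral>\<^sup>+e. ennreal (F e) \<partial>unif_sphere N) \<le> ennreal (2 * exp (2 * real N * (\<theta> * K + \<bar>w\<bar>) * \<delta>)) *
      (\<integral>\<^sup>+e. ennreal (F e) * indicator {e. \<forall>i<N. norm (e i) \<le> t} e \<partial>unif_sphere N)" (is ?A)
    and "0 < (\<integral>\<^sup>+e. ennreal (F e) \<partial>unif_sphere N)" (is ?B)
    and "(\<integral>\<^sup>+e. ennreal (F e) \<partial>unif_sphere N) < \<infinity>" (is ?C)
proof -
  let ?M = "lebesgue_prod N :: (nat \<Rightarrow> 'a) measure"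
  let ?r = "\<lambda>x::nat \<Rightarrow> 'a. L2_set (\<lambda>i. norm (x i)) {..<N}"
  let ?L = "\<theta> * K + \<bar>w\<bar>"
  let ?P = "indicator {e::nat \<Rightarrow> 'a. \<forall>i\<in>{..<N}. norm (e i) \<le> t} :: _ \<Rightarrow> ennreal"
  define S where "S = {x. ?r x \<in> {sqrt (1 - \<delta>)<..sqrt (1 + \<delta>)}}"
  \<comment> \<open>The common constant relating shell integrals to unit ball integrals; being
    positive and finite, it can be cancelled at the end.\<close>
  define C where "C = ennreal (sqrt (1 + \<delta>) ^ (DIM('a) * N) - sqrt (1 - \<delta>) ^ (DIM('a) * N))"
  have C: "0 < C" "C < \<infinity>"
    using N \<delta> by (auto simp: C_def ennreal_less_zero_iff DIM_positive intro!: power_strict_mono)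
  have K0: "0 \<le> K" using K[of 0] N by auto
  have Z: "0 < Z" unfolding Z_def using c N by (intro prod_pos) auto
  have gZ: "(\<integral>\<^sup>+x. g x \<partial>?M) = ennreal Z"
    unfolding g_def Z_def using c N by (intro nn_integral_gaussian_prod) auto
  have [measurable]: "F \<in> borel_measurable (\<Pi>\<^sub>M i\<in>{..<N}. borel)" unfolding F_def by measurable
  have [measurable]: "?P \<in> borel_measurable (\<Pi>\<^sub>M i\<in>{..<N}. borel)"
    by (rule borel_measurable_indicator') measurable
  have [measurable]: "g \<in> borel_measurable ?M" unfolding g_def by measurable
  have r2: "(?r x)\<^sup>2 = (\<Sum>i<N. (norm (x i))\<^sup>2)" for x
    by (simp add: L2_set_def sum_nonneg)
  have S_iff: "x \<in> S \<longleftrightarrow> 1 - \<delta> < (?r x)\<^sup>2 \<and> (?r x)\<^sup>2 \<le> 1 + \<delta>" for x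
  proof -
    have "x \<in> S \<longleftrightarrow> sqrt (1 - \<delta>) < sqrt ((?r x)\<^sup>2) \<and> sqrt ((?r x)\<^sup>2) \<le> sqrt (1 + \<delta>)"
      by (simp add: S_def L2_set_nonneg)
    then show ?thesis by (simp only: real_sqrt_less_iff real_sqrt_le_iff)
  qed
  have norm_n: "(\<Sum>i<N. d i * (norm (normalised N x i))\<^sup>2) = (\<Sum>i<N. d i * (norm (x i))\<^sup>2) / (?r x)\<^sup>2" for x
    by (simp add: normalised_def L2_set_nonneg sum_divide_distrib power_mult_distrib power_inverse divide_inverse mult_ac)
       (simp add: sum_distrib_left mult_ac)
  have q: "\<bar>\<Sum>i<N. d i * (norm (x i))\<^sup>2\<bar> \<le> K * (?r x)\<^sup>2" for x
  proof -
    have "\<bar>\<Sum>i<N. d i * (norm (x i))\<^sup>2\<bar> \<le> (\<Sum>i<N. K * (norm (x i))\<^sup>2)"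
      using K by (intro order.trans[OF sum_abs] sum_mono) (auto simp: abs_mult intro!: mult_right_mono)
    then show ?thesis by (simp add: r2 sum_distrib_left)
  qed
  have FK: "F (normalised N x) \<le> exp (real N * \<theta> * K)" for x
  proof -
    \<comment> \<open>At the zero vector the quotient is 0 by the convention for division, and there
      the bound rests on \<open>0 \<le> K\<close>.\<close>
    have "(\<Sum>i<N. d i * (norm (x i))\<^sup>2) / (?r x)\<^sup>2 \<le> K"
      using q[of x] K0 by (cases "(?r x)\<^sup>2 = 0") (auto simp: divide_le_eq abs_le_iff)
    then have "real N * \<theta> * ((\<Sum>i<N. d i * (norm (x i))\<^sup>2) / (?r x)\<^sup>2) \<le> real N * \<theta> * K"
      using \<theta> by (intro mult_left_mono) auto
    then show ?thesis unfolding F_def norm_n exp_le_cancel_iff .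
  qed
  \<comment> \<open>With the ball volume \<open>V\<close>, the two spherical integrals are
    \<open>J / V\<close> and \<open>J' / V\<close>.\<close>
  define J where "J = (\<integral>\<^sup>+x. ennreal (F (normalised N x)) * indicator (unit_ball N) x \<partial>?M)"
  define J' where "J' = (\<integral>\<^sup>+x. (ennreal (F (normalised N x)) * ?P (normalised N x)) * indicator (unit_ball N) x \<partial>?M)"
  define V where "V = emeasure ?M (unit_ball N)"
  \<comment> \<open>No formula for the volume of the ball is used: it is finite because the
    indicator of the ball lies below a multiple of a Gaussian weight.\<close>
  have "V \<le> (\<integral>\<^sup>+x. ennreal (exp 1) * ennreal (exp (- (\<Sum>i<N. 1 * (norm (x i))\<^sup>2))) \<partial>?M)"
  proof -
    have "V = (\<integral>\<^sup>+x. indicator (unit_ball N) x \<partial>?M)" by (simp add: V_def)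
    also have "\<dots> \<le> (\<integral>\<^sup>+x. ennreal (exp 1) * ennreal (exp (- (\<Sum>i<N. 1 * (norm (x i))\<^sup>2))) \<partial>?M)"
    proof (intro nn_integral_mono)
      fix x :: "nat \<Rightarrow> 'a"
      have "1 \<le> exp 1 * exp (- (\<Sum>i<N. 1 * (norm (x i))\<^sup>2))" if "?r x \<le> 1"
        using that r2[of x] power_le_one[of "?r x" 2] by (simp add: exp_add[symmetric] L2_set_nonneg)
      then show "indicator (unit_ball N) x \<le> ennreal (exp 1) * ennreal (exp (- (\<Sum>i<N. 1 * (norm (x i))\<^sup>2)))"
        by (auto simp: ennreal_mult[symmetric] simp flip: ennreal_1 split: split_indicator)
    qed
    finally show ?thesis .
  qed
  also have "\<dots> = ennreal (exp 1) * ennreal (\<Prod>i<N. sqrt (pi / 1) ^ DIM('a))"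
    using nn_integral_gaussian_prod[where 'a='a, of N "\<lambda>_. 1"] by (subst nn_integral_cmult) auto
  also have "\<dots> < \<infinity>" by (simp add: ennreal_mult_less_top)
  finally have Vfin: "V < \<infinity>" .
  have "J \<le> (\<integral>\<^sup>+x. ennreal (exp (real N * \<theta> * K)) * indicator (unit_ball N) x \<partial>?M)"
    unfolding J_def using FK by (intro nn_integral_mono mult_right_mono ennreal_leI) auto
  also have "\<dots> = ennreal (exp (real N * \<theta> * K)) * V"
    unfolding V_def by (intro nn_integral_cmult_indicator) measurable
  finally have JV: "J \<le> ennreal (exp (real N * \<theta> * K)) * V" .
  then have Jfin: "J < \<infinity>" using Vfin by (auto simp: ennreal_mult_less_top intro: le_less_trans)
  have J'J: "J' \<le> J" unfolding J_def J'_def by (intro nn_integral_mono) (auto split: split_indicator)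
  have shellJ: "(\<integral>\<^sup>+x. ennreal (F (normalised N x)) * indicator S x \<partial>?M) = C * J"
    unfolding S_def C_def J_def using \<delta> Jfin by (intro nn_integral_shell) (auto simp: J_def)
  have shellJ': "(\<integral>\<^sup>+x. (ennreal (F (normalised N x)) * ?P (normalised N x)) * indicator S x \<partial>?M) = C * J'"
    unfolding S_def C_def J'_def using \<delta> J'J Jfin
    by (intro nn_integral_shell[where f = "\<lambda>x. ennreal (F x) * ?P x"]) (auto simp: J'_def)
  \<comment> \<open>With \<open>s = |x|^2\<close> and \<open>q\<close> the quadratic form at
    \<open>x\<close>, the difference of the exponents is exactly
    \<open>N * (\<theta> * q / s - w) * (1 - s)\<close>. The last factor is at most \<delta> on the
    shell, the middle one at most \<open>L\<close>.\<close>
  have F_near: "\<bar>real N * \<theta> * (\<Sum>i<N. d i * (norm (normalised N x i))\<^sup>2) -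
      (real N * w - (\<Sum>i<N. real N * (w - \<theta> * d i) * (norm (x i))\<^sup>2))\<bar> \<le> real N * ?L * \<delta>"
    if x: "x \<in> S" for x
  proof -
    let ?s = "(?r x)\<^sup>2" and ?q = "\<Sum>i<N. d i * (norm (x i))\<^sup>2"
    have s: "\<bar>1 - ?s\<bar> \<le> \<delta>" "?s > 0" using x \<delta> S_iff by auto
    have sum: "(\<Sum>i<N. real N * (w - \<theta> * d i) * (norm (x i))\<^sup>2) = real N * (w * ?s - \<theta> * ?q)"
      by (simp add: r2 sum_distrib_left sum_subtractf left_diff_distrib right_diff_distrib mult_ac)
    have qK: "\<bar>?q / ?s\<bar> \<le> K" using q[of x] s by (simp add: divide_le_eq)
    have "real N * \<theta> * (?q / ?s) - (real N * w - real N * (w * ?s - \<theta> * ?q)) =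
        real N * ((\<theta> * (?q / ?s) - w) * (1 - ?s))"
      using s by (simp add: field_simps)
    also have "\<bar>\<dots>\<bar> = real N * (\<bar>\<theta> * (?q / ?s) - w\<bar> * \<bar>1 - ?s\<bar>)" by (simp only: abs_mult abs_of_nat)
    also have "\<dots> \<le> real N * (?L * \<delta>)"
    proof (intro mult_left_mono mult_mono)
      have "\<bar>\<theta> * (?q / ?s)\<bar> \<le> \<theta> * K" using mult_left_mono[OF qK \<theta>] by (simp only: abs_mult abs_of_nonneg[OF \<theta>])
      then show "\<bar>\<theta> * (?q / ?s) - w\<bar> \<le> ?L" by linarith
    qed (use s K0 \<theta> in auto)
    finally show ?thesis unfolding norm_n sum by (simp add: mult.assoc)
  qed
  \<comment> \<open>For the upper bound the Gaussian integral may be extended from the shell to the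
    whole space.\<close>
  have upper: "C * J \<le> ennreal (exp (real N * ?L * \<delta> + real N * w)) * ennreal Z"
  proof -
    have "C * J \<le> (\<integral>\<^sup>+x. ennreal (exp (real N * ?L * \<delta> + real N * w)) * g x \<partial>?M)"
      unfolding shellJ[symmetric]
    proof (intro nn_integral_mono)
      fix x :: "nat \<Rightarrow> 'a"
      have "F (normalised N x) \<le> exp (real N * ?L * \<delta> + real N * w) *
          exp (- (\<Sum>i<N. real N * (w - \<theta> * d i) * (norm (x i))\<^sup>2))" if "x \<in> S"
        using F_near[OF that] unfolding F_def exp_add[symmetric] exp_le_cancel_iff by linarith
      then show "ennreal (F (normalised N x)) * indicator S x \<le>
          ennreal (exp (real N * ?L * \<delta> + real N * w)) * g x"
        by (auto simp: g_def ennreal_mult[symmetric] split: split_indicator)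
    qed
    also have "\<dots> = ennreal (exp (real N * ?L * \<delta> + real N * w)) * ennreal Z"
      by (subst nn_integral_cmult) (auto simp: gZ)
    finally show ?thesis .
  qed
  \<comment> \<open>The Gaussian mass of the shell vectors with delocalised direction.\<close>
  define G where "G = (\<integral>\<^sup>+x. g x * (?P (normalised N x) * indicator S x) \<partial>?M)"
  have S_meas[measurable]: "indicator S \<in> borel_measurable ?M" (is "?IS \<in> _")
  proof -
    have "?IS = (\<lambda>x. indicator {sqrt (1 - \<delta>)<..sqrt (1 + \<delta>)} (?r x))"
      by (auto simp: S_def split: split_indicator)
    then show ?thesis by simp
  qed
  have lower: "ennreal (exp (- (real N * ?L * \<delta>) + real N * w)) * G \<le> C * J'"
  proof -
    have "ennreal (exp (- (real N * ?L * \<delta>) + real N * w)) * G =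
        (\<integral>\<^sup>+x. ennreal (exp (- (real N * ?L * \<delta>) + real N * w)) * (g x * (?P (normalised N x) * indicator S x)) \<partial>?M)"
      unfolding G_def by (subst nn_integral_cmult) auto
    also have "\<dots> \<le> C * J'"
      unfolding shellJ'[symmetric]
    proof (intro nn_integral_mono)
      fix x :: "nat \<Rightarrow> 'a"
      have "exp (- (real N * ?L * \<delta>) + real N * w) *
          exp (- (\<Sum>i<N. real N * (w - \<theta> * d i) * (norm (x i))\<^sup>2)) \<le> F (normalised N x)" if "x \<in> S"
        using F_near[OF that] unfolding F_def exp_add[symmetric] exp_le_cancel_iff by linarith
      then show "ennreal (exp (- (real N * ?L * \<delta>) + real N * w)) * (g x * (?P (normalised N x) * indicator S x)) \<le>
          ennreal (F (normalised N x)) * ?P (normalised N x) * indicator S x"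
        by (auto simp: g_def ennreal_mult[symmetric] intro!: ennreal_leI split: split_indicator)
    qed
    finally show ?thesis .
  qed
  have "ennreal Z \<le> G + ennreal (Z / 2)"
  proof -
    let ?B1 = "{x::nat \<Rightarrow> 'a. (\<Sum>i<N. (norm (x i))\<^sup>2) \<le> 1 - \<delta>}"
    let ?B2 = "{x::nat \<Rightarrow> 'a. 1 + \<delta> \<le> (\<Sum>i<N. (norm (x i))\<^sup>2)}"
    \<comment> \<open>In the shell, a normalised coordinate above \<open>t\<close> means
      \<open>|x i| > t * |x|\<close> with \<open>|x|^2 > 1 - \<delta>\<close>, which explains the
      level \<open>t\<^sup>2 * (1 - \<delta>)\<close>. It turns a condition on the direction into
      one on a single Gaussian coordinate.\<close>
    let ?B3 = "\<lambda>i. {x::nat \<Rightarrow> 'a. t\<^sup>2 * (1 - \<delta>) \<le> (norm (x i))\<^sup>2}"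
    have [measurable]: "indicator ?B1 \<in> borel_measurable ?M" "indicator ?B2 \<in> borel_measurable ?M"
      by (rule borel_measurable_indicator'; measurable)+
    have [measurable]: "i < N \<Longrightarrow> indicator (?B3 i) \<in> borel_measurable ?M" for i
      by (rule borel_measurable_indicator') measurable
    have cover: "1 \<le> ?P (normalised N x) * indicator S x + (indicator ?B1 x + indicator ?B2 x + (\<Sum>i<N. indicator (?B3 i) x) :: ennreal)"
      for x :: "nat \<Rightarrow> 'a"
    proof (cases "x \<in> S")
      case False
      then have "x \<in> ?B1 \<or> x \<in> ?B2" using S_iff r2 by (auto simp: not_less not_le)
      then have "(1::ennreal) \<le> indicator ?B1 x + indicator ?B2 x" by (auto simp: indicator_def)
      then show ?thesis by (meson add_increasing add_increasing2 zero_le)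
    next
      case True
      show ?thesis
      proof (cases "\<forall>i\<in>{..<N}. norm (normalised N x i) \<le> t")
        case True
        with \<open>x \<in> S\<close> have "(1::ennreal) \<le> ?P (normalised N x) * indicator S x" by simp
        then show ?thesis by (meson add_increasing2 zero_le)
      next
        case False
        then obtain i where i: "i < N" "t < norm (normalised N x i)" by auto
        have s: "1 - \<delta> < (?r x)\<^sup>2" using True S_iff by auto
        then have "?r x \<noteq> 0" using \<delta> by auto
        then have rp: "0 < ?r x" by (metis L2_set_nonneg less_le)
        have "t * ?r x < norm (x i)"
          using i rp by (simp add: normalised_def field_simps)
        then have "(t * ?r x)\<^sup>2 \<le> (norm (x i))\<^sup>2" using t rp by (intro power_mono) auto
        moreover have "t\<^sup>2 * (1 - \<delta>) \<le> (t * ?r x)\<^sup>2"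
          using s by (auto simp: power_mult_distrib intro!: mult_left_mono)
        ultimately have "(1::ennreal) \<le> indicator (?B3 i) x" by simp
        also have "\<dots> \<le> (\<Sum>i<N. indicator (?B3 i) x)" using i by (intro member_le_sum) auto
        finally show ?thesis by (meson add_increasing zero_le)
      qed
    qed
    have "ennreal Z = (\<integral>\<^sup>+x. g x * 1 \<partial>?M)" by (simp add: gZ)
    also have "\<dots> \<le> (\<integral>\<^sup>+x. g x * (?P (normalised N x) * indicator S x + (indicator ?B1 x + indicator ?B2 x + (\<Sum>i<N. indicator (?B3 i) x))) \<partial>?M)"
      by (intro nn_integral_mono mult_left_mono cover) auto
    also have "\<dots> = G + ((\<integral>\<^sup>+x. g x * indicator ?B1 x \<partial>?M) + (\<integral>\<^sup>+x. g x * indicator ?B2 x \<partial>?M) +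
        (\<Sum>i<N. \<integral>\<^sup>+x. g x * indicator (?B3 i) x \<partial>?M))"
      unfolding G_def by (rule nn_integral_mult_cover) measurable
    also have "\<dots> \<le> G + ennreal (Z / 2)" using bad by (intro add_left_mono)
    finally show ?thesis .
  qed
  moreover have "ennreal Z = ennreal (Z / 2) + ennreal (Z / 2)"
    using Z by (simp add: ennreal_plus[symmetric] del: ennreal_plus)
  ultimately have G: "ennreal (Z / 2) \<le> G"
    by (metis add.commute ennreal_add_left_cancel_le ennreal_neq_top infinity_ennreal_def)
  have CJ': "0 < C * J'"
  proof -
    have "0 < ennreal (exp (- (real N * ?L * \<delta>) + real N * w)) * ennreal (Z / 2)"
      using Z by (simp add: ennreal_zero_less_mult_iff)
    also have "\<dots> \<le> ennreal (exp (- (real N * ?L * \<delta>) + real N * w)) * G" by (intro mult_left_mono G) auto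
    also note lower
    finally show ?thesis .
  qed
  then have J'pos: "0 < J'" by (simp add: ennreal_zero_less_mult_iff)
  then have Jpos: "0 < J" using J'J by simp
  \<comment> \<open>Positivity of the ball volume is a by-product: \<open>J\<close> is positive and
    bounded by a multiple of \<open>V\<close>.\<close>
  then have Vpos: "0 < V" using JV by (cases "V = 0") (auto simp: zero_less_iff_neq_zero)
  let ?c = "2 * exp (2 * real N * ?L * \<delta>)"
  have "C * J \<le> ennreal (exp (real N * ?L * \<delta> + real N * w)) * ennreal Z" by (rule upper)
  also have "\<dots> = ennreal ?c * (ennreal (exp (- (real N * ?L * \<delta>) + real N * w)) * ennreal (Z / 2))"
  proof -
    have "exp (real N * ?L * \<delta> + real N * w) = exp (2 * real N * ?L * \<delta>) * exp (- (real N * ?L * \<delta>) + real N * w)"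
      by (simp add: exp_add[symmetric] mult_ac)
    then show ?thesis using Z by (simp add: ennreal_mult[symmetric])
  qed
  also have "\<dots> \<le> ennreal ?c * (ennreal (exp (- (real N * ?L * \<delta>) + real N * w)) * G)"
    by (intro mult_left_mono G) auto
  also have "\<dots> \<le> ennreal ?c * (C * J')" by (intro mult_left_mono lower) auto
  also have "\<dots> = C * (ennreal ?c * J')" by (simp add: mult_ac)
  finally have JJ': "J \<le> ennreal ?c * J'"
    using C by (simp add: ennreal_mult_le_mult_iff)
  have EF: "(\<integral>\<^sup>+e. ennreal (F e) \<partial>unif_sphere N) = J / V"
    unfolding J_def V_def by (intro nn_integral_unif_sphere) auto
  have "(\<integral>\<^sup>+e. ennreal (F e) * ?P e \<partial>unif_sphere N) = J' / V"
    unfolding J'_def V_def by (subst nn_integral_unif_sphere) auto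
  then have EF': "(\<integral>\<^sup>+e. ennreal (F e) * indicator {e. \<forall>i<N. norm (e i) \<le> t} e \<partial>unif_sphere N) = J' / V"
    by (simp add: Ball_def)
  show ?A unfolding EF EF' using divide_right_mono_ennreal[OF JJ', of V]
    by (simp add: divide_ennreal_def mult_ac)
  show ?B unfolding EF using Jpos Vfin by (simp add: divide_ennreal_def ennreal_zero_less_mult_iff ennreal_inverse_positive)
  show ?C unfolding EF using Jfin Vpos Vfin
    by (cases J; cases V) (auto simp: divide_ennreal ennreal_less_zero_iff)
qed

section \<open>Concentration of the Gaussian law\<close>

text \<open>Exponential Markov bounds for each of the three ways to be bad. For the radius, tilting
  by \<open>N * s\<close> gains \<open>N * s * \<delta>\<close> in the exponent; the deviation of
  the mean from 1 costs half of this and the quadratic term a quarter, by the last condition on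
  \<open>s\<close>. The remaining quarter is the decay rate.\<close>

lemma gaussian_mass_outside_le:
  fixes c :: "nat \<Rightarrow> real" and t \<delta> c0 s :: real
  assumes N: "1 \<le> N" and \<delta>: "0 < \<delta>" "\<delta> < 1" and c0: "0 < c0" and c: "\<And>i. i < N \<Longrightarrow> c0 \<le> c i"
    and mean: "\<bar>(\<Sum>i<N. real DIM('a) / 2 / c i) / real N - 1\<bar> \<le> \<delta> / 2"
    and s: "0 < s" "s \<le> c0 / 2" "real DIM('a) * s \<le> \<delta> / 4 * c0\<^sup>2"
  defines "g \<equiv> \<lambda>x::nat \<Rightarrow> 'a::euclidean_space. ennreal (exp (- (\<Sum>i<N. real N * c i * (norm (x i))\<^sup>2)))"
    and "Z \<equiv> \<Prod>i<N. sqrt (pi / (real N * c i)) ^ DIM('a)"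
  shows "(\<integral>\<^sup>+x. g x * indicator {x. (\<Sum>i<N. (norm (x i))\<^sup>2) \<le> 1 - \<delta>} x \<partial>lebesgue_prod N) +
      (\<integral>\<^sup>+x. g x * indicator {x. 1 + \<delta> \<le> (\<Sum>i<N. (norm (x i))\<^sup>2)} x \<partial>lebesgue_prod N) +
      (\<Sum>i<N. \<integral>\<^sup>+x. g x * indicator {x. t\<^sup>2 * (1 - \<delta>) \<le> (norm (x i))\<^sup>2} x \<partial>lebesgue_prod N) \<le>
    ennreal ((2 * exp (- (real N * s * \<delta> / 4)) +
      real N * exp (real DIM('a) / 2 - real N * c0 / 2 * (t\<^sup>2 * (1 - \<delta>)))) * Z)"
proof -
  let ?n = "real DIM('a)"
  have Np: "0 < real N" using N by simp
  have cp: "0 < c i" if "i < N" for i using c[OF that] c0 by simp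
  have Z: "0 \<le> Z" unfolding Z_def using cp by (intro prod_nonneg) (auto simp: less_imp_le)
  \<comment> \<open>The cost of the quadratic terms of the tilt, for either sign \<epsilon>.\<close>
  have sq: "(\<Sum>i<N. 2 * (\<epsilon> * s / c i)\<^sup>2) * (?n / 2) \<le> real N * s * \<delta> / 4" if \<epsilon>: "\<epsilon>\<^sup>2 = 1" for \<epsilon> :: real
  proof -
    have "(\<epsilon> * s / c i)\<^sup>2 \<le> s\<^sup>2 / c0\<^sup>2" if "i < N" for i
      using \<epsilon> c[OF that] c0 s by (simp add: power_divide power_mult_distrib frac_le power_mono)
    then have "(\<Sum>i<N. 2 * (\<epsilon> * s / c i)\<^sup>2) \<le> (\<Sum>i<N. 2 * (s\<^sup>2 / c0\<^sup>2))"
      by (intro sum_mono mult_left_mono) auto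
    then have "(\<Sum>i<N. 2 * (\<epsilon> * s / c i)\<^sup>2) * (?n / 2) \<le> real N * (2 * (s\<^sup>2 / c0\<^sup>2)) * (?n / 2)"
      by (intro mult_right_mono) auto
    also have "\<dots> = real N * s * (?n * s / c0\<^sup>2)" by (simp add: power2_eq_square)
    also have "\<dots> \<le> real N * s * (\<delta> / 4)"
      using s c0 by (intro mult_left_mono) (auto simp: divide_le_eq)
    finally show ?thesis by simp
  qed
  \<comment> \<open>Both radial tails at once: \<epsilon> = 1 is the upper tail and \<epsilon> = -1
    the lower one.\<close>
  have shell: "(\<integral>\<^sup>+x. g x * indicator A x \<partial>lebesgue_prod N) \<le> ennreal (exp (- (real N * s * \<delta> / 4)) * Z)"
    if \<epsilon>: "\<epsilon> = 1 \<or> \<epsilon> = -1" and A: "\<And>x. x \<in> A \<Longrightarrow> \<epsilon> + \<delta> \<le> \<epsilon> * (\<Sum>i<N. (norm (x i))\<^sup>2)"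
    for \<epsilon> :: real and A :: "(nat \<Rightarrow> 'a) set"
  proof -
    have "(\<integral>\<^sup>+x. g x * indicator A x \<partial>lebesgue_prod N) \<le>
        ennreal (exp (?n / 2 * (\<Sum>i<N. real N * (\<epsilon> * s) / (real N * c i) + 2 * (real N * (\<epsilon> * s) / (real N * c i))\<^sup>2) -
          real N * s * (\<epsilon> + \<delta>)) * Z)"
      unfolding g_def Z_def
    proof (rule gaussian_markov)
      fix i assume i: "i < N"
      show "0 < real N * c i" using cp[OF i] Np by simp
      show "\<bar>real N * (\<epsilon> * s) / (real N * c i)\<bar> \<le> 1 / 2"
        using \<epsilon> Np s c[OF i] cp[OF i] by (auto simp: abs_mult abs_divide divide_le_eq)
    next
      fix x assume "x \<in> A"
      then have "real N * s * (\<epsilon> + \<delta>) \<le> real N * s * (\<epsilon> * (\<Sum>i<N. (norm (x i))\<^sup>2))"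
        using A s Np by (intro mult_left_mono) auto
      then show "real N * s * (\<epsilon> + \<delta>) \<le> (\<Sum>i<N. real N * (\<epsilon> * s) * (norm (x i))\<^sup>2)"
        by (simp add: sum_distrib_left mult_ac)
    qed
    also have "\<dots> \<le> ennreal (exp (- (real N * s * \<delta> / 4)) * Z)"
    proof (intro ennreal_leI mult_right_mono Z, unfold exp_le_cancel_iff)
      have eq: "?n / 2 * (\<Sum>i<N. real N * (\<epsilon> * s) / (real N * c i) + 2 * (real N * (\<epsilon> * s) / (real N * c i))\<^sup>2) =
          \<epsilon> * s * (\<Sum>i<N. ?n / 2 / c i) + (\<Sum>i<N. 2 * (\<epsilon> * s / c i)\<^sup>2) * (?n / 2)"
        using Np by (simp add: sum.distrib distrib_left sum_distrib_left mult_ac)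
      have m: "\<bar>(\<Sum>i<N. ?n / 2 / c i) - real N\<bar> \<le> real N * \<delta> / 2"
      proof -
        have "(\<Sum>i<N. ?n / 2 / c i) - real N = real N * ((\<Sum>i<N. ?n / 2 / c i) / real N - 1)"
          using Np by (simp add: field_simps)
        also have "\<bar>\<dots>\<bar> = real N * \<bar>(\<Sum>i<N. ?n / 2 / c i) / real N - 1\<bar>"
          by (simp only: abs_mult abs_of_nat)
        also have "\<dots> \<le> real N * (\<delta> / 2)" using mean by (intro mult_left_mono) auto
        finally show ?thesis by simp
      qed
      have "\<epsilon> * s * (\<Sum>i<N. ?n / 2 / c i) - real N * s * \<epsilon> \<le> s * (real N * \<delta> / 2)"
      proof -
        have "\<epsilon> * s * (\<Sum>i<N. ?n / 2 / c i) - real N * s * \<epsilon> = s * (\<epsilon> * ((\<Sum>i<N. ?n / 2 / c i) - real N))"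
          by (simp add: algebra_simps)
        also have "\<dots> \<le> s * (real N * \<delta> / 2)"
        proof (intro mult_left_mono)
          have "\<epsilon> * x \<le> y" if "\<bar>x\<bar> \<le> y" for x y :: real using \<epsilon> that by auto
          then show "\<epsilon> * ((\<Sum>i<N. ?n / 2 / c i) - real N) \<le> real N * \<delta> / 2" using m .
        qed (use s in auto)
        finally show ?thesis .
      qed
      moreover have "real N * s * (\<epsilon> + \<delta>) = real N * s * \<epsilon> + real N * s * \<delta>" by (simp add: distrib_left)
      moreover have "\<epsilon>\<^sup>2 = 1" using \<epsilon> by auto
      ultimately show "?n / 2 * (\<Sum>i<N. real N * (\<epsilon> * s) / (real N * c i) + 2 * (real N * (\<epsilon> * s) / (real N * c i))\<^sup>2) -
          real N * s * (\<epsilon> + \<delta>) \<le> - (real N * s * \<delta> / 4)"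
        unfolding eq using sq[of \<epsilon>] by (simp add: mult_ac)
    qed
    finally show ?thesis .
  qed
  have coord: "(\<integral>\<^sup>+x. g x * indicator {x. \<tau> \<le> (norm (x i))\<^sup>2} x \<partial>lebesgue_prod N) \<le>
      ennreal (exp (?n / 2 - real N * c0 / 2 * \<tau>) * Z)" if i: "i < N" for i \<tau>
  proof -
    \<comment> \<open>Only coordinate \<open>i\<close> is tilted, by half the lower bound on its
      coefficient. The relative tilt \<open>u\<close> is then at most 1/2 and
      \<open>u + 2 * u\<^sup>2 \<le> 1\<close>, so the cost does not grow with
      \<open>N\<close>.\<close>
    let ?h = "\<lambda>j. if j = i then real N * c0 / 2 else 0"
    have u: "0 \<le> c0 / (2 * c i)" "c0 / (2 * c i) \<le> 1 / 2" using c0 c[OF i] by (simp_all add: divide_le_eq)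
    have "(\<integral>\<^sup>+x. g x * indicator {x. \<tau> \<le> (norm (x i))\<^sup>2} x \<partial>lebesgue_prod N) \<le>
        ennreal (exp (?n / 2 * (\<Sum>j<N. ?h j / (real N * c j) + 2 * (?h j / (real N * c j))\<^sup>2) -
          real N * c0 / 2 * \<tau>) * Z)"
      unfolding g_def Z_def
    proof (rule gaussian_markov)
      fix j assume j: "j < N"
      show "0 < real N * c j" using cp[OF j] Np by simp
      show "\<bar>?h j / (real N * c j)\<bar> \<le> 1 / 2"
        using Np u c0 c[OF i] by (auto simp: divide_le_eq)
    next
      fix x :: "nat \<Rightarrow> 'a" assume x: "x \<in> {x. \<tau> \<le> (norm (x i))\<^sup>2}"
      have "(\<Sum>j<N. ?h j * (norm (x j))\<^sup>2) = (\<Sum>j<N. if j = i then real N * c0 / 2 * (norm (x j))\<^sup>2 else 0)"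
        by (intro sum.cong) auto
      also have "\<dots> = real N * c0 / 2 * (norm (x i))\<^sup>2" using i by simp
      finally show "real N * c0 / 2 * \<tau> \<le> (\<Sum>j<N. ?h j * (norm (x j))\<^sup>2)"
        using x c0 by (auto intro!: mult_left_mono)
    qed
    also have "\<dots> \<le> ennreal (exp (?n / 2 - real N * c0 / 2 * \<tau>) * Z)"
    proof (intro ennreal_leI mult_right_mono Z, unfold exp_le_cancel_iff, intro diff_right_mono)
      have "(\<Sum>j<N. ?h j / (real N * c j) + 2 * (?h j / (real N * c j))\<^sup>2) =
          (\<Sum>j<N. if j = i then c0 / (2 * c j) + 2 * (c0 / (2 * c j))\<^sup>2 else 0)"
        using Np by (intro sum.cong) auto
      also have "\<dots> = c0 / (2 * c i) + 2 * (c0 / (2 * c i))\<^sup>2" using i by simp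
      also have "\<dots> \<le> 1 / 2 + 2 * (1 / 2)\<^sup>2" using u by (intro add_mono mult_left_mono power_mono) auto
      also have "\<dots> = 1" by (simp add: power2_eq_square)
      finally show "?n / 2 * (\<Sum>j<N. ?h j / (real N * c j) + 2 * (?h j / (real N * c j))\<^sup>2) \<le> ?n / 2"
        using mult_left_mono[of _ 1 "?n / 2"] by simp
    qed
    finally show ?thesis .
  qed
  let ?e = "exp (- (real N * s * \<delta> / 4))" and ?f = "exp (?n / 2 - real N * c0 / 2 * (t\<^sup>2 * (1 - \<delta>)))"
  have "(\<integral>\<^sup>+x. g x * indicator {x. (\<Sum>i<N. (norm (x i))\<^sup>2) \<le> 1 - \<delta>} x \<partial>lebesgue_prod N) +
      (\<integral>\<^sup>+x. g x * indicator {x. 1 + \<delta> \<le> (\<Sum>i<N. (norm (x i))\<^sup>2)} x \<partial>lebesgue_prod N) +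
      (\<Sum>i<N. \<integral>\<^sup>+x. g x * indicator {x. t\<^sup>2 * (1 - \<delta>) \<le> (norm (x i))\<^sup>2} x \<partial>lebesgue_prod N) \<le>
      ennreal (?e * Z) + ennreal (?e * Z) + (\<Sum>i<N. ennreal (?f * Z))"
    using coord by (intro add_mono sum_mono shell[of "-1"] shell[of 1]) auto
  also have "\<dots> = ennreal ((2 * ?e + real N * ?f) * Z)"
    using Z by (simp add: ennreal_of_nat_eq_real_of_nat ennreal_mult[symmetric] ennreal_plus[symmetric]
        distrib_right mult.assoc del: ennreal_plus)
  finally show ?thesis .
qed

text \<open>For \<open>t = N powr (- 3 / 8)\<close> the product \<open>N * t\<^sup>2\<close> is
  \<open>N powr (1 / 4)\<close>, so even \<open>N\<close> coordinate tails add up to a vanishing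
  mass. The radial tails decay exponentially, since \<open>s\<close> does not depend on
  \<open>N\<close>. Thus the bad mass is eventually below one half.\<close>

lemma sphere_deloc_eventually:
  fixes d :: "nat \<Rightarrow> nat \<Rightarrow> real" and K w \<theta> c0 \<delta> :: real
  assumes \<theta>: "0 \<le> \<theta>" and c0: "0 < c0" and \<delta>: "0 < \<delta>" "\<delta> \<le> 1 / 2"
    and K: "\<forall>\<^sub>F N in sequentially. \<forall>i<N. \<bar>d N i\<bar> \<le> K"
    and c: "\<forall>\<^sub>F N in sequentially. \<forall>i<N. c0 \<le> w - \<theta> * d N i"
    and mean: "(\<lambda>N. (\<Sum>i<N. real DIM('a::euclidean_space) / 2 / (w - \<theta> * d N i)) / real N) \<longlonglongrightarrow> 1"
  defines "F \<equiv> \<lambda>N (e::nat \<Rightarrow> 'a). exp (real N * \<theta> * (\<Sum>i<N. d N i * (norm (e i))\<^sup>2))"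
  shows "\<forall>\<^sub>F N in sequentially.
    (\<integral>\<^sup>+e. ennreal (F N e) \<partial>unif_sphere N) \<le> ennreal (2 * exp (2 * real N * (\<theta> * K + \<bar>w\<bar>) * \<delta>)) *
      (\<integral>\<^sup>+e. ennreal (F N e) * indicator {e. \<forall>i<N. norm (e i) \<le> real N powr (- 3 / 8)} e \<partial>unif_sphere N) \<and>
    0 < (\<integral>\<^sup>+e. ennreal (F N e) \<partial>unif_sphere N) \<and>
    (\<integral>\<^sup>+e. ennreal (F N e) \<partial>unif_sphere N) < \<infinity>"
proof -
  let ?n = "real DIM('a)"
  \<comment> \<open>The largest tilt meeting both upper bounds required for the radial
    estimate.\<close>
  define s where "s = min (c0 / 2) (\<delta> / 4 * c0\<^sup>2 / ?n)"
  have s: "0 < s" "s \<le> c0 / 2" using c0 \<delta> by (auto simp: s_def)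
  have "s \<le> \<delta> / 4 * c0\<^sup>2 / ?n" by (simp add: s_def)
  then have s3: "?n * s \<le> \<delta> / 4 * c0\<^sup>2" by (simp add: le_divide_eq mult.commute)
  have "\<forall>\<^sub>F N in sequentially. 2 * exp (- (real N * s * \<delta> / 4)) +
      real N * exp (?n / 2 - real N * c0 / 2 * ((real N powr (- 3 / 8))\<^sup>2 * (1 - \<delta>))) < 1 / 2"
  proof (rule order_tendstoD)
    have "((\<lambda>N. 2 * exp (- (real N * p)) +
        exp k * (real N * exp (- (real N * (real N powr (- 3 / 8))\<^sup>2 * q)))) \<longlongrightarrow> 0) sequentially"
      if "0 < p" "0 < q" for p q k :: real
      using that by real_asymp
    from this[of "s * \<delta> / 4" "c0 / 2 * (1 - \<delta>)" "?n / 2"] s c0 \<delta>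
    have lim: "((\<lambda>N. 2 * exp (- (real N * (s * \<delta> / 4))) + exp (?n / 2) *
        (real N * exp (- (real N * (real N powr (- 3 / 8))\<^sup>2 * (c0 / 2 * (1 - \<delta>)))))) \<longlongrightarrow> 0) sequentially"
      by simp
    have eq: "(\<lambda>N. 2 * exp (- (real N * (s * \<delta> / 4))) + exp (?n / 2) *
        (real N * exp (- (real N * (real N powr (- 3 / 8))\<^sup>2 * (c0 / 2 * (1 - \<delta>)))))) =
        (\<lambda>N. 2 * exp (- (real N * s * \<delta> / 4)) +
          real N * exp (?n / 2 - real N * c0 / 2 * ((real N powr (- 3 / 8))\<^sup>2 * (1 - \<delta>))))"
      by (simp add: diff_conv_add_uminus exp_add mult_ac fun_eq_iff del: add_uminus_conv_diff)
    show "((\<lambda>N. 2 * exp (- (real N * s * \<delta> / 4)) +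
        real N * exp (?n / 2 - real N * c0 / 2 * ((real N powr (- 3 / 8))\<^sup>2 * (1 - \<delta>)))) \<longlongrightarrow> 0) sequentially"
      by (rule back_subst[where P = "\<lambda>f. (f \<longlongrightarrow> 0) sequentially", OF lim eq])
  qed simp
  moreover have "\<forall>\<^sub>F N in sequentially.
      \<bar>(\<Sum>i<N. ?n / 2 / (w - \<theta> * d N i)) / real N - 1\<bar> < \<delta> / 2"
    using tendstoD[OF mean, of "\<delta> / 2"] \<delta> by (simp add: dist_real_def)
  ultimately show ?thesis using K c eventually_ge_at_top[of 1]
  proof eventually_elim
    case (elim N)
    let ?c = "\<lambda>i. w - \<theta> * d N i" and ?t = "real N powr (- 3 / 8)"
    let ?Z = "\<Prod>i<N. sqrt (pi / (real N * ?c i)) ^ DIM('a)"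
    have cp: "0 < ?c i" if "i < N" for i using elim(4) c0 that by force
    have Z: "0 \<le> ?Z" using cp by (intro prod_nonneg) (auto simp: less_imp_le)
    have "(2 * exp (- (real N * s * \<delta> / 4)) + real N * exp (?n / 2 - real N * c0 / 2 * (?t\<^sup>2 * (1 - \<delta>)))) * ?Z \<le>
        1 / 2 * ?Z"
      using elim(1) Z by (intro mult_right_mono) auto
    then have le: "ennreal ((2 * exp (- (real N * s * \<delta> / 4)) +
        real N * exp (?n / 2 - real N * c0 / 2 * (?t\<^sup>2 * (1 - \<delta>)))) * ?Z) \<le> ennreal (?Z / 2)"
      by (intro ennreal_leI) simp
    have t: "0 < ?t" using elim(5) by simp
    note bad = order.trans[OF gaussian_mass_outside_le[where 'a='a and c = ?c and t = ?t, OF elim(5) \<delta>(1) _ c0 _ _ s s3] le]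
    note main = sphere_ratio[where 'a='a and w=w and \<theta>=\<theta> and d="d N" and K=K and t = ?t, OF elim(5) \<delta>(1) _ \<theta> _ cp t bad]
    show ?case unfolding F_def using main elim \<delta> by auto
  qed
qed

section \<open>Diagonal matrices and the Cauchy transform\<close>

text \<open>Recovers the multiset of roots from a split polynomial; this gives the uniqueness behind
  the definite description in \<open>eigs\<close>.\<close>

lemma order_prod_linear:
  fixes x :: "'a::field"
  shows "order x (\<Prod>a\<leftarrow>as. [:- a, 1:]) = count (mset as) x"
proof (induction as)
  case (Cons a as)
  have "(\<Prod>a\<leftarrow>as. [:- a, 1:]) \<noteq> 0" by (auto simp: prod_list_zero_iff)
  then have "[:- a, 1:] * (\<Prod>a\<leftarrow>as. [:- a, 1:]) \<noteq> 0" by (intro no_zero_divisors) auto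
  from order_mult[OF this] Cons show ?case
    using order_power_n_n[of a 1] by (auto simp: order_root intro: order_0I)
qed (simp add: order_1_eq_0)

text \<open>The sorted diagonal qualifies because the matrix is triangular. It is the only such
  list: the polynomial fixes the multiset of roots, and a sorted list is fixed by its
  multiset.\<close>

lemma eigs_diagonal:
  assumes M: "M \<in> carrier_mat N N" "diagonal_mat M" and re: "\<And>i. i < N \<Longrightarrow> M $$ (i, i) \<in> \<real>"
  shows "eigs M = sort (map (\<lambda>i. Re (M $$ (i, i))) [0..<N])"
proof -
  let ?ds = "map (\<lambda>i. Re (M $$ (i, i))) [0..<N]"
  let ?p = "\<lambda>as. \<Prod>a\<leftarrow>as. [:- complex_of_real a, 1:]"
  have p_mset: "?p as = prod_mset (image_mset (\<lambda>a. [:- complex_of_real a, 1:]) (mset as))" for as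
    by (simp flip: mset_map add: prod_mset_prod_list)
  have "upper_triangular M" using M by (auto simp: diagonal_mat_def)
  then have "char_poly M = (\<Prod>a\<leftarrow>diag_mat M. [:- a, 1:])" using M by (intro char_poly_upper_triangular)
  also have "diag_mat M = map complex_of_real ?ds"
    using M re by (auto simp: diag_mat_def of_real_Re)
  finally have char: "char_poly M = ?p ?ds" by (simp add: comp_def)
  show ?thesis unfolding eigs_def
  proof (rule the_equality)
    show "sorted (sort ?ds) \<and> char_poly M = ?p (sort ?ds)" unfolding char p_mset by simp
  next
    fix as assume as: "sorted as \<and> char_poly M = ?p as"
    then have "order x (?p as) = order x (?p ?ds)" for x using char by simp
    then have "count (mset (map complex_of_real as)) x = count (mset (map complex_of_real ?ds)) x" for x
      using order_prod_linear[of x "map complex_of_real as"] order_prod_linear[of x "map complex_of_real ?ds"]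
      by (simp add: comp_def)
    then have "mset (map complex_of_real as) = mset (map complex_of_real ?ds)" by (intro multiset_eqI)
    then have "image_mset complex_of_real (mset as) = image_mset complex_of_real (mset ?ds)" by (simp only: mset_map)
    then have "mset as = mset ?ds" using multiset.inj_map[of complex_of_real] by (auto simp: inj_def)
    then show "as = sort ?ds" using as by (intro properties_for_sort[symmetric]) auto
  qed
qed

lemma eigval_diagonal_bounds:
  assumes M: "M \<in> carrier_mat N N" "diagonal_mat M" and re: "\<And>i. i < N \<Longrightarrow> M $$ (i, i) \<in> \<real>" and i: "i < N"
  shows "eigval M 1 \<le> Re (M $$ (i, i))" "Re (M $$ (i, i)) \<le> eigval M N"
proof -
  let ?ds = "map (\<lambda>i. Re (M $$ (i, i))) [0..<N]"
  have "Re (M $$ (i, i)) \<in> set (sort ?ds)" using i by auto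
  then obtain k where "k < N" "sort ?ds ! k = Re (M $$ (i, i))" 
    unfolding in_set_conv_nth by auto
  then show "eigval M 1 \<le> Re (M $$ (i, i))" "Re (M $$ (i, i)) \<le> eigval M N"
    using i sorted_nth_mono[of "sort ?ds" 0 k] sorted_nth_mono[of "sort ?ds" k "N - 1"]
    by (auto simp: eigval_def eigs_diagonal[OF M re])
qed

lemma measurable_eigval: "eigval M \<in> measurable (uniform_count_measure {1..n}) borel"
  by (simp add: measurable_cong_sets[OF sets_uniform_count_measure_count_space refl])

text \<open>Sorting only permutes the diagonal entries, which a sum does not notice.\<close>

lemma integral_emp_measure_diagonal:
  fixes f :: "real \<Rightarrow> real"
  assumes M: "M \<in> carrier_mat N N" "diagonal_mat M" and re: "\<And>i. i < N \<Longrightarrow> M $$ (i, i) \<in> \<real>"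
    and f: "f \<in> borel_measurable borel"
  shows "(LINT x|emp_measure M. f x) = (\<Sum>i<N. f (Re (M $$ (i, i)))) / real N"
proof -
  let ?ds = "map (\<lambda>i. Re (M $$ (i, i))) [0..<N]"
  have "(LINT x|emp_measure M. f x) = (LINT k|uniform_count_measure {1..dim_row M}. f (eigval M k))"
    unfolding emp_measure_def using f measurable_eigval by (intro integral_distr) auto
  also have "\<dots> = (\<Sum>k\<in>{1..N}. f (sort ?ds ! (k - 1))) / real N"
    using M by (subst integral_uniform_count_measure) (auto simp: eigval_def eigs_diagonal[OF M re])
  also have "(\<Sum>k\<in>{1..N}. f (sort ?ds ! (k - 1))) = (\<Sum>k<N. f (sort ?ds ! k))"
    by (rule sum.reindex_bij_witness[of _ Suc "\<lambda>k. k - 1"]) auto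
  also have "\<dots> = sum_list (map f (sort ?ds))"
    by (simp add: sum_list_sum_nth atLeast0LessThan)
  also have "\<dots> = sum_mset (image_mset f (mset (sort ?ds)))" by (simp only: sum_mset_sum_list mset_map[symmetric])
  also have "\<dots> = sum_list (map f ?ds)" by (simp only: mset_sort sum_mset_sum_list mset_map[symmetric])
  also have "\<dots> = (\<Sum>i<N. f (Re (M $$ (i, i))))" by (simp add: sum_list_sum_nth atLeast0LessThan)
  finally show ?thesis .
qed

lemma real_distribution_emp_measure:
  assumes "M \<in> carrier_mat N N" "1 \<le> N"
  shows "real_distribution (emp_measure M)"
proof -
  interpret prob_space "uniform_count_measure {1..dim_row M}"
    using assms by (intro prob_space_uniform_count_measure) auto
  show ?thesis unfolding emp_measure_def by (rule real_distribution_distr) (rule measurable_eigval)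
qed

section \<open>The Cauchy transform to the right of the support\<close>

context
  fixes \<mu> :: "real measure"
  assumes \<mu>: "real_distribution \<mu>" and compact: "compact (msupport \<mu>)"
begin

interpretation real_distribution \<mu> by (rule \<mu>)

text \<open>Every point beyond the right end has an open neighbourhood of measure zero. By the
  Lindelof property countably many such sets cover all these points, so their union is still
  null.\<close>

lemma AE_le_right_end: "AE t in \<mu>. t \<le> right_end \<mu>"
proof -
  let ?\<F> = "{U. open U \<and> emeasure \<mu> U = 0}"
  obtain \<F> where \<F>: "\<F> \<subseteq> ?\<F>" "countable \<F>" "\<Union>\<F> = \<Union>?\<F>" by (rule Lindelof[of ?\<F>]) auto
  have "\<Union>\<F> \<in> null_sets \<mu>"
    using \<F> by (intro null_sets_UN'[of \<F> "\<lambda>U. U", simplified] null_setsI) auto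
  moreover have "t \<in> \<Union>\<F>" if "\<not> t \<le> right_end \<mu>" for t
  proof -
    have "bdd_above (msupport \<mu>)"
      using compact by (intro bounded_imp_bdd_above compact_imp_bounded)
    then have "t \<notin> msupport \<mu>"
      using that cSup_upper[of t "msupport \<mu>"] by (auto simp: right_end_def)
    then show ?thesis unfolding \<F>(3) by (auto simp: msupport_def not_gr_zero)
  qed
  ultimately show ?thesis by (intro AE_I'[of "\<Union>\<F>"]) auto
qed

lemma AE_cauchy_kernel_le:
  assumes "right_end \<mu> < x" "x \<le> y"
  shows "AE t in \<mu>. 0 \<le> 1 / (y - t) \<and> 1 / (y - t) \<le> 1 / (x - right_end \<mu>)"
  using AE_le_right_end by eventually_elim (use assms in \<open>auto intro!: frac_le\<close>)

lemma integrable_cauchy_kernel: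
  assumes "right_end \<mu> < y"
  shows "integrable \<mu> (\<lambda>t. 1 / (y - t))"
  using AE_cauchy_kernel_le[OF assms order_refl]
  by (intro integrable_const_bound[of _ "1 / (y - right_end \<mu>)"]) auto

lemma cauchy_transform_antimono:
  assumes "right_end \<mu> < x" "x \<le> y"
  shows "cauchy_transform \<mu> y \<le> cauchy_transform \<mu> x"
  unfolding cauchy_transform_def
proof (rule integral_mono_AE)
  show "AE t in \<mu>. 1 / (y - t) \<le> 1 / (x - t)"
    using AE_le_right_end by eventually_elim (use assms in \<open>auto intro!: frac_le\<close>)
qed (use assms in \<open>auto intro!: integrable_cauchy_kernel\<close>)

text \<open>Gives the decay at infinity for the intermediate value argument.\<close>

lemma cauchy_transform_le:
  assumes "right_end \<mu> < y"
  shows "cauchy_transform \<mu> y \<le> 1 / (y - right_end \<mu>)"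
proof -
  have "cauchy_transform \<mu> y \<le> (LINT t|\<mu>. 1 / (y - right_end \<mu>))"
    unfolding cauchy_transform_def using assms AE_cauchy_kernel_le[OF assms order_refl]
    by (intro integral_mono_AE integrable_cauchy_kernel) (auto elim: eventually_mono)
  then show ?thesis using prob_space by simp
qed

text \<open>The difference of two kernels is their product times \<open>y - x\<close>, so the
  transform is Lipschitz as long as the argument stays away from the support.\<close>

lemma cauchy_transform_continuous:
  assumes "right_end \<mu> < x0"
  shows "continuous_on {x0..} (cauchy_transform \<mu>)"
proof (rule lipschitz_on_continuous_on[of "(1 / (x0 - right_end \<mu>))\<^sup>2"], rule lipschitz_onI)
  let ?c = "1 / (x0 - right_end \<mu>)"
  fix x y assume "x \<in> {x0..}" and "y \<in> {x0..}"
  then have x: "x0 \<le> x" and y: "x0 \<le> y" by auto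
  have "cauchy_transform \<mu> x - cauchy_transform \<mu> y = (LINT t|\<mu>. 1 / (x - t) - 1 / (y - t))"
    unfolding cauchy_transform_def using assms x y
    by (intro Bochner_Integration.integral_diff[symmetric] integrable_cauchy_kernel) auto
  also have "norm \<dots> \<le> (LINT t|\<mu>. norm (1 / (x - t) - 1 / (y - t)))"
    by (rule integral_norm_bound)
  also have "\<dots> \<le> (LINT t|\<mu>. ?c\<^sup>2 * \<bar>x - y\<bar>)"
  proof (rule integral_mono_AE)
    show "AE t in \<mu>. norm (1 / (x - t) - 1 / (y - t)) \<le> ?c\<^sup>2 * \<bar>x - y\<bar>"
      using AE_le_right_end AE_cauchy_kernel_le[OF assms x] AE_cauchy_kernel_le[OF assms y]
    proof eventually_elim
      case (elim t)
      have "1 / (x - t) - 1 / (y - t) = (1 / (x - t)) * (1 / (y - t)) * (y - x)"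
        using elim x y assms by (simp add: field_simps)
      also have "norm \<dots> = (1 / (x - t)) * (1 / (y - t)) * \<bar>x - y\<bar>"
        using elim x y by (simp only: norm_mult real_norm_def) (simp add: abs_minus_commute)
      also have "\<dots> \<le> ?c * ?c * \<bar>x - y\<bar>"
        using elim x y assms by (intro mult_right_mono mult_mono) auto
      finally show ?case by (simp add: power2_eq_square)
    qed
  qed (use assms x y in \<open>auto intro!: integrable_cauchy_kernel Bochner_Integration.integrable_diff integrable_norm\<close>)
  finally show "dist (cauchy_transform \<mu> x) (cauchy_transform \<mu> y) \<le> ?c\<^sup>2 * dist x y"
    using prob_space by (simp add: dist_real_def)
qed simp

text \<open>The transform is decreasing, so its right limit is the supremum of its values, possibly
  infinite. Convergence has to be shown first, as \<open>Lim\<close> says nothing about functions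
  without a limit.\<close>

lemma G_right_end_le:
  assumes "\<And>y. right_end \<mu> < y \<Longrightarrow> cauchy_transform \<mu> y \<le> c"
  shows "G_right_end \<mu> \<le> ereal c"
proof -
  let ?G = "\<lambda>y. ereal (cauchy_transform \<mu> y)"
  let ?S = "SUP y\<in>{right_end \<mu><..}. ?G y"
  have "(?G \<longlongrightarrow> ?S) (at_right (right_end \<mu>))"
  proof (rule order_tendstoI)
    fix a assume "a < ?S"
    then obtain y where y: "right_end \<mu> < y" "a < ?G y" by (auto simp: less_SUP_iff)
    have "\<forall>\<^sub>F x in at_right (right_end \<mu>). right_end \<mu> < x \<and> x < y"
      using y(1) eventually_at_right_field by blast
    then show "\<forall>\<^sub>F x in at_right (right_end \<mu>). a < ?G x"
    proof eventually_elim
      case (elim x)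
      then have "?G y \<le> ?G x" using cauchy_transform_antimono[of x y] by simp
      with y(2) show ?case by (rule less_le_trans)
    qed
  next
    fix a assume a: "?S < a"
    have "\<forall>\<^sub>F x in at_right (right_end \<mu>). right_end \<mu> < x" by (simp add: eventually_at_right_less)
    then show "\<forall>\<^sub>F x in at_right (right_end \<mu>). ?G x < a"
    proof eventually_elim
      case (elim x)
      then have "?G x \<le> ?S" by (intro SUP_upper) auto
      from this a show ?case by (rule le_less_trans)
    qed
  qed
  then have "G_right_end \<mu> = ?S"
    unfolding G_right_end_def by (intro tendsto_Lim) (auto simp: trivial_limit_at_right_real)
  also have "\<dots> \<le> ereal c" using assms by (intro SUP_least) auto
  finally show ?thesis .
qed

text \<open>Below the threshold the transform exceeds \<open>2 * \<theta> / \<beta>\<close>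
  somewhere, for otherwise \<open>theta_c\<close> would be at most \<theta>. Further right it falls
  to this level, and continuity yields a point in between.\<close>

lemma saddle_point_exists:
  assumes "0 < \<theta>" "1 \<le> \<beta>" "ereal \<theta> < theta_c \<beta> \<mu>"
  obtains v where "right_end \<mu> < v" "real \<beta> / 2 * cauchy_transform \<mu> v = \<theta>"
proof -
  let ?c = "2 * \<theta> / real \<beta>"
  have c: "0 < ?c" using assms by simp
  have "\<exists>x>right_end \<mu>. ?c < cauchy_transform \<mu> x"
  proof (rule ccontr)
    assume "\<not> ?thesis"
    then have le: "G_right_end \<mu> \<le> ereal ?c" by (intro G_right_end_le) (meson not_le)
    then have "theta_c \<beta> \<mu> = ereal (real \<beta> / 2) * G_right_end \<mu>"
      unfolding theta_c_def using le_less_trans[OF le, of \<infinity>] by simp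
    also have "\<dots> \<le> ereal (real \<beta> / 2) * ereal ?c" using le by (intro ereal_mult_left_mono) auto
    also have "\<dots> = ereal \<theta>" using assms(2) by simp
    finally show False using assms(3) by simp
  qed
  then obtain x where x: "right_end \<mu> < x" "?c < cauchy_transform \<mu> x" by auto
  \<comment> \<open>Far enough for the decay bound to give a value of at most \<open>?c\<close>, and
    not to the left of \<open>x\<close>.\<close>
  define y where "y = max x (right_end \<mu> + 1 / ?c)"
  have y: "x \<le> y" "right_end \<mu> + 1 / ?c \<le> y" by (auto simp: y_def)
  have "0 < 1 / ?c" using c by (simp only: zero_less_divide_1_iff)
  then have "1 / (y - right_end \<mu>) \<le> 1 / (1 / ?c)" using y by (intro divide_left_mono mult_pos_pos) linarith+
  then have "cauchy_transform \<mu> y \<le> ?c"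
    using cauchy_transform_le[of y] x y by simp
  moreover have "continuous_on {x..y} (cauchy_transform \<mu>)"
    using cauchy_transform_continuous[OF x(1)] by (rule continuous_on_subset) auto
  ultimately obtain v where "x \<le> v" "cauchy_transform \<mu> v = ?c"
    using IVT2'[of "cauchy_transform \<mu>" y ?c x] x y by auto
  then show thesis using x assms(2) by (intro that[of v]) auto
qed

text \<open>Weak convergence needs a bounded continuous integrand, which the kernel is not. It is
  truncated to \<open>f\<close>, which agrees with it up to \<open>x\<close>; there the limit law is
  carried and, eventually, all entries lie.\<close>

lemma emp_mean_tendsto:
  fixes d :: "nat \<Rightarrow> nat \<Rightarrow> real" and \<nu> :: "nat \<Rightarrow> real measure"
  assumes \<nu>: "\<And>N. 1 \<le> N \<Longrightarrow> real_distribution (\<nu> N)" and conv: "weak_conv_m \<nu> \<mu>"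
    and int: "\<And>N f. 1 \<le> N \<Longrightarrow> f \<in> borel_measurable borel \<Longrightarrow> (LINT x|\<nu> N. f x) = (\<Sum>i<N. f (d N i)) / real N"
    and x: "right_end \<mu> < x" "x < v" and d: "\<forall>\<^sub>F N in sequentially. \<forall>i<N. d N i \<le> x"
  shows "(\<lambda>N. (\<Sum>i<N. 1 / (v - d N i)) / real N) \<longlonglongrightarrow> cauchy_transform \<mu> v"
proof -
  define f where "f t = 1 / max (v - x) (v - t)" for t
  have pos: "0 < max (v - x) (v - t)" for t using x by auto
  have cont: "isCont f t" for t
    unfolding f_def using pos[of t] by (intro continuous_intros) auto
  have bound: "norm (f t) \<le> 1 / (v - x)" for t
    using x pos[of t] by (auto simp: f_def intro!: divide_left_mono)
  have meas: "f \<in> borel_measurable borel" unfolding f_def by measurable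
  \<comment> \<open>The shift drops index 0, for which \<open>\<nu>\<close> is not assumed to be a
    probability measure.\<close>
  have "weak_conv_m (\<lambda>N. \<nu> (Suc N)) \<mu>"
    using conv unfolding weak_conv_m_def weak_conv_def by (auto intro: LIMSEQ_Suc)
  then have "(\<lambda>N. LINT t|\<nu> (Suc N). f t) \<longlonglongrightarrow> (LINT t|\<mu>. f t)"
    using \<nu> cont bound by (intro weak_conv_imp_integral_bdd_continuous_conv[OF _ \<mu>]) auto
  then have "(\<lambda>N. LINT t|\<nu> N. f t) \<longlonglongrightarrow> (LINT t|\<mu>. f t)"
    by (rule LIMSEQ_imp_Suc)
  moreover have "(LINT t|\<mu>. f t) = cauchy_transform \<mu> v"
    unfolding cauchy_transform_def
  proof (rule integral_cong_AE)
    show "AE t in \<mu>. f t = 1 / (v - t)"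
      using AE_le_right_end by eventually_elim (use x in \<open>auto simp: f_def max_def\<close>)
  qed (use meas in auto)
  moreover have "\<forall>\<^sub>F N in sequentially. (LINT t|\<nu> N. f t) = (\<Sum>i<N. 1 / (v - d N i)) / real N"
    using d eventually_ge_at_top[of 1]
  proof eventually_elim
    case (elim N)
    have "(\<Sum>i<N. f (d N i)) = (\<Sum>i<N. 1 / (v - d N i))"
      using elim(1) by (intro sum.cong) (auto simp: f_def max_def)
    then show ?case using int[OF elim(2) meas] by simp
  qed
  ultimately show ?thesis by (simp add: tendsto_cong)
qed

end

section \<open>The limit\<close>

text \<open>The normalised logarithm lies between \<open>- ln 2 / N - 2 * L * \<delta>\<close> and
  0, and \<delta> is arbitrary. Positivity of the quotient is recorded because \<open>ln\<close> is
  meaningful only there.\<close>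

lemma log_ratio_tendsto_0:
  fixes a b :: "nat \<Rightarrow> real"
  assumes L: "0 \<le> L"
    and bound: "\<And>\<delta>. 0 < \<delta> \<Longrightarrow> \<delta> \<le> 1 / 2 \<Longrightarrow>
      \<forall>\<^sub>F N in sequentially. 0 < a N \<and> b N \<le> a N \<and> a N \<le> 2 * exp (2 * real N * L * \<delta>) * b N"
  shows "(\<forall>\<^sub>F N in sequentially. b N / a N > 0) \<and> (\<lambda>N. 1 / real N * ln (b N / a N)) \<longlonglongrightarrow> 0"
proof
  show "\<forall>\<^sub>F N in sequentially. b N / a N > 0"
    using bound[of "1 / 2"]
  proof (rule eventually_mono)
    fix N assume "0 < a N \<and> b N \<le> a N \<and> a N \<le> 2 * exp (2 * real N * L * (1 / 2)) * b N"
    then have "0 < a N" "0 < 2 * exp (2 * real N * L * (1 / 2)) * b N" by linarith+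
    then show "b N / a N > 0" by (simp add: zero_less_mult_iff)
  qed auto
  show "(\<lambda>N. 1 / real N * ln (b N / a N)) \<longlonglongrightarrow> 0"
  proof (rule tendstoI)
    fix \<epsilon> :: real assume \<epsilon>: "0 < \<epsilon>"
    \<comment> \<open>Makes \<open>2 * L * \<delta>\<close> at most half of \<epsilon>; using
      \<open>L + 1\<close> avoids dividing by zero when \<open>L = 0\<close>.\<close>
    define \<delta> where "\<delta> = min (1 / 2) (\<epsilon> / (4 * (L + 1)))"
    have \<delta>: "0 < \<delta>" using \<epsilon> L by (auto simp: \<delta>_def)
    have \<delta>2: "\<delta> \<le> 1 / 2" unfolding \<delta>_def by (rule min.cobounded1)
    have "L * \<delta> \<le> (L + 1) * (\<epsilon> / (4 * (L + 1)))"
      using L \<delta> unfolding \<delta>_def by (intro mult_mono min.cobounded2) auto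
    also have "\<dots> = \<epsilon> / 4" using L by (simp add: field_simps)
    finally have L\<delta>: "2 * L * \<delta> \<le> \<epsilon> / 2" by simp
    have "(\<lambda>N. ln 2 / real N) \<longlonglongrightarrow> 0" by real_asymp
    then have "\<forall>\<^sub>F N in sequentially. ln 2 / real N < \<epsilon> / 2" using \<epsilon> by (intro order_tendstoD) auto
    then show "\<forall>\<^sub>F N in sequentially. dist (1 / real N * ln (b N / a N)) 0 < \<epsilon>"
      using bound[OF \<delta> \<delta>2] eventually_gt_at_top[of 0]
    proof eventually_elim
      case (elim N)
      let ?E = "2 * real N * L * \<delta>"
      have a: "0 < a N" and "0 < 2 * exp ?E * b N" using elim(2) by linarith+
      then have b: "0 < b N" by (simp add: zero_less_mult_iff)
      have "ln (b N / a N) \<le> 0" using a b elim(2) by simp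
      moreover have "ln (a N) \<le> ln (2 * exp ?E * b N)" using a b elim(2) by simp
      then have "- (ln 2 + ?E) \<le> ln (b N / a N)" using a b by (simp add: ln_mult ln_div)
      ultimately have "\<bar>ln (b N / a N)\<bar> \<le> ln 2 + ?E" by linarith
      then have "\<bar>ln (b N / a N)\<bar> / real N \<le> (ln 2 + ?E) / real N" by (intro divide_right_mono) auto
      also have "\<dots> = ln 2 / real N + 2 * L * \<delta>" using elim(3) by (simp add: field_simps)
      also have "\<dots> < \<epsilon>" using elim(1) L\<delta> by linarith
      finally show ?case by (simp add: dist_real_def abs_mult)
    qed
  qed
qed

text \<open>Carries the estimates over from nonnegative to Bochner integrals, where finiteness makes
  the conversion faithful. The hypothesis \<open>mean\<close> says that the expected squared norm
  under the Gaussian law tends to 1.\<close>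

lemma sphere_deloc_limit:
  fixes d :: "nat \<Rightarrow> nat \<Rightarrow> real" and K w \<theta> c0 :: real
  assumes \<theta>: "0 \<le> \<theta>" and c0: "0 < c0"
    and K: "\<forall>\<^sub>F N in sequentially. \<forall>i<N. \<bar>d N i\<bar> \<le> K"
    and c: "\<forall>\<^sub>F N in sequentially. \<forall>i<N. c0 \<le> w - \<theta> * d N i"
    and mean: "(\<lambda>N. (\<Sum>i<N. real DIM('a::euclidean_space) / 2 / (w - \<theta> * d N i)) / real N) \<longlonglongrightarrow> 1"
  defines "F \<equiv> \<lambda>N (e::nat \<Rightarrow> 'a). exp (real N * \<theta> * (\<Sum>i<N. d N i * (norm (e i))\<^sup>2))"
  defines "a \<equiv> \<lambda>N. LINT e|unif_sphere N. F N e"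
    and "b \<equiv> \<lambda>N. LINT e|unif_sphere N. indicator {e. \<forall>i<N. norm (e i) \<le> real N powr (- 3 / 8)} e * F N e"
  shows "(\<forall>\<^sub>F N in sequentially. b N / a N > 0) \<and> (\<lambda>N. 1 / real N * ln (b N / a N)) \<longlonglongrightarrow> 0"
proof (rule log_ratio_tendsto_0)
  have "\<forall>\<^sub>F N in sequentially. 0 \<le> K"
    using K eventually_gt_at_top[of 0] by eventually_elim (meson abs_ge_zero order_trans)
  \<comment> \<open>A statement free of \<open>N\<close> that holds eventually is true.\<close>
  then have "0 \<le> K" by simp
  then show "0 \<le> \<theta> * K + \<bar>w\<bar>" using \<theta> by simp
next
  fix \<delta> :: real assume \<delta>: "0 < \<delta>" "\<delta> \<le> 1 / 2"
  show "\<forall>\<^sub>F N in sequentially. 0 < a N \<and> b N \<le> a N \<and> a N \<le> 2 * exp (2 * real N * (\<theta> * K + \<bar>w\<bar>) * \<delta>) * b N"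
    using sphere_deloc_eventually[where 'a='a, OF \<theta> c0 \<delta> K c mean]
  proof (rule eventually_mono)
    fix N
    let ?P = "indicator {e::nat \<Rightarrow> 'a. \<forall>i<N. norm (e i) \<le> real N powr (- 3 / 8)}"
    let ?F = "\<lambda>e::nat \<Rightarrow> 'a. exp (real N * \<theta> * (\<Sum>i<N. d N i * (norm (e i))\<^sup>2))"
    let ?A = "\<integral>\<^sup>+e. ennreal (?F e) \<partial>unif_sphere N" and ?B = "\<integral>\<^sup>+e. ennreal (?F e) * ?P e \<partial>unif_sphere N"
    let ?c = "2 * exp (2 * real N * (\<theta> * K + \<bar>w\<bar>) * \<delta>)"
    assume *: "?A \<le> ennreal ?c * ?B \<and> 0 < ?A \<and> ?A < \<infinity>"
    have sets: "sets (unif_sphere N :: (nat \<Rightarrow> 'a) measure) = sets (\<Pi>\<^sub>M i\<in>{..<N}. borel)"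
      by (simp add: unif_sphere_def)
    have F: "?F \<in> borel_measurable (unif_sphere N)"
      unfolding measurable_cong_sets[OF sets refl] by measurable
    have "(indicator {e::nat \<Rightarrow> 'a. \<forall>i\<in>{..<N}. norm (e i) \<le> real N powr (- 3 / 8)} :: _ \<Rightarrow> real) \<in>
        borel_measurable (\<Pi>\<^sub>M i\<in>{..<N}. borel)"
      by (rule borel_measurable_indicator') measurable
    then have P: "(?P :: _ \<Rightarrow> real) \<in> borel_measurable (unif_sphere N)"
      unfolding measurable_cong_sets[OF sets refl] by (simp add: Ball_def)
    have a: "a N = enn2real ?A"
      unfolding a_def F_def using F by (intro integral_eq_nn_integral) auto
    have "b N = enn2real (\<integral>\<^sup>+e. ennreal (?P e * ?F e) \<partial>unif_sphere N)"
      unfolding b_def F_def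
      by (rule integral_eq_nn_integral[OF borel_measurable_times[OF P F]]) (rule AE_I2, simp)
    also have "(\<integral>\<^sup>+e. ennreal (?P e * ?F e) \<partial>unif_sphere N) = ?B"
    proof (intro nn_integral_cong)
      show "ennreal (indicator S e * x) = ennreal x * indicator S e" for x S and e :: "nat \<Rightarrow> 'a"
        by (simp split: split_indicator)
    qed
    finally have b: "b N = enn2real ?B" .
    have "x * indicator S e \<le> x" for x :: ennreal and S and e :: "nat \<Rightarrow> 'a"
      by (simp split: split_indicator)
    then have BA: "?B \<le> ?A" by (intro nn_integral_mono)
    obtain x where x: "?A = ennreal x" "0 \<le> x" using * by (cases ?A) auto
    have "?B < \<infinity>" using BA * by (blast intro: le_less_trans)
    then obtain y where y: "?B = ennreal y" "0 \<le> y" by (cases ?B) auto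
    have "0 < ennreal x" "ennreal y \<le> ennreal x" "ennreal x \<le> ennreal (?c * y)"
      using * BA unfolding x(1) y(1) by (simp_all add: ennreal_mult y(2))
    then show "0 < a N \<and> b N \<le> a N \<and> a N \<le> ?c * b N"
      unfolding a b x(1) y(1) using x(2) y(2) by simp
  qed
qed

section \<open>Reduction of the matrix quantities to the diagonal entries\<close>

lemma quad_form_diagonal:
  assumes M: "M \<in> carrier_mat N N" "diagonal_mat M" and re: "\<And>i. i < N \<Longrightarrow> M $$ (i, i) \<in> \<real>"
  shows "quad_form M e = (\<Sum>i<N. Re (M $$ (i, i)) * (cmod (e i))\<^sup>2)"
proof -
  let ?v = "Matrix.vec N e"
  have row: "vec_index (M *\<^sub>v ?v) i = M $$ (i, i) * e i" if i: "i < N" for i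
  proof -
    have "vec_index (M *\<^sub>v ?v) i = (\<Sum>j\<in>{0..<N}. M $$ (i, j) * e j)"
      using M i by (simp add: scalar_prod_def)
    also have "\<dots> = (\<Sum>j\<in>{0..<N}. if j = i then M $$ (i, i) * e i else 0)"
      using M i by (intro sum.cong) (auto simp: diagonal_mat_def)
    finally show ?thesis using i by simp
  qed
  have "(M *\<^sub>v ?v) \<bullet>c ?v = (\<Sum>i\<in>{0..<N}. vec_index (M *\<^sub>v ?v) i * cnj (e i))"
    using M by (simp add: scalar_prod_def[of _ "conjugate ?v"] del: index_mult_mat_vec)
  also have "\<dots> = (\<Sum>i<N. M $$ (i, i) * complex_of_real ((cmod (e i))\<^sup>2))"
    unfolding atLeast0LessThan using row
    by (intro sum.cong) (auto simp: mult.assoc complex_norm_square simp del: of_real_power)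
  also have "Re \<dots> = (\<Sum>i<N. Re (M $$ (i, i)) * (cmod (e i))\<^sup>2)" by simp
  finally show ?thesis using M by (simp add: quad_form_def Let_def)
qed

lemma sup_norm_le_iff: "1 \<le> N \<Longrightarrow> sup_norm N e \<le> t \<longleftrightarrow> (\<forall>i<N. cmod (e i) \<le> t)"
  unfolding sup_norm_def by (subst Max_le_iff) (auto simp: lessThan_empty_iff)

lemma integral_sphere_law_1:
  assumes f: "f \<in> borel_measurable (\<Pi>\<^sub>M i\<in>{..<N}. borel)"
  shows "(LINT e|sphere_law 1 N. f e :: real) =
    (LINT x|unif_sphere N. f (\<lambda>i\<in>{..<N}. complex_of_real (x i)))"
proof -
  have sets: "sets (unif_sphere N :: (nat \<Rightarrow> real) measure) = sets (\<Pi>\<^sub>M i\<in>{..<N}. borel)"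
    by (simp add: unif_sphere_def)
  have "(\<lambda>x. \<lambda>i\<in>{..<N}. complex_of_real (x i)) \<in> measurable (unif_sphere N) (\<Pi>\<^sub>M i\<in>{..<N}. borel)"
    unfolding measurable_cong_sets[OF sets refl] by measurable
  then show ?thesis unfolding sphere_law_def using f by (simp add: integral_distr)
qed

text \<open>Only the moduli of the coordinates matter, and the embedding of the reals preserves
  them. So \<beta> = 1 can be treated on the real sphere itself.\<close>

lemma I_sph_diagonal:
  assumes N: "1 \<le> N" and M: "M \<in> carrier_mat N N" "diagonal_mat M" and re: "\<And>i. i < N \<Longrightarrow> M $$ (i, i) \<in> \<real>"
  defines "d \<equiv> \<lambda>i. Re (M $$ (i, i))"
  shows "I_sph 1 N M \<theta> = (LINT e|(unif_sphere N :: (nat \<Rightarrow> real) measure). exp (real N * \<theta> * (\<Sum>i<N. d i * (norm (e i))\<^sup>2)))"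
    and "I_sph_deloc 1 N M \<theta> = (LINT e|(unif_sphere N :: (nat \<Rightarrow> real) measure).
      indicator {e. \<forall>i<N. norm (e i) \<le> real N powr (- 3 / 8)} e * exp (real N * \<theta> * (\<Sum>i<N. d i * (norm (e i))\<^sup>2)))"
    and "I_sph 2 N M \<theta> = (LINT e|(unif_sphere N :: (nat \<Rightarrow> complex) measure). exp (real N * \<theta> * (\<Sum>i<N. d i * (norm (e i))\<^sup>2)))"
    and "I_sph_deloc 2 N M \<theta> = (LINT e|(unif_sphere N :: (nat \<Rightarrow> complex) measure).
      indicator {e. \<forall>i<N. norm (e i) \<le> real N powr (- 3 / 8)} e * exp (real N * \<theta> * (\<Sum>i<N. d i * (norm (e i))\<^sup>2)))"
proof -
  let ?F = "\<lambda>e::nat \<Rightarrow> complex. exp (real N * \<theta> * (\<Sum>i<N. d i * (norm (e i))\<^sup>2))"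
  let ?P = "\<lambda>e::nat \<Rightarrow> complex. indicator {e. \<forall>i<N. norm (e i) \<le> real N powr (- 3 / 8)} e :: real"
  have q: "quad_form M e = (\<Sum>i<N. d i * (norm (e i))\<^sup>2)" for e
    unfolding d_def using M re by (intro quad_form_diagonal) auto
  have I: "I_sph \<beta> N M \<theta> = (LINT e|sphere_law \<beta> N. ?F e)" for \<beta>
    unfolding I_sph_def q ..
  have I': "I_sph_deloc \<beta> N M \<theta> = (LINT e|sphere_law \<beta> N. ?P e * ?F e)" for \<beta>
    unfolding I_sph_deloc_def q sup_norm_le_iff[OF N] ..
  have F: "?F \<in> borel_measurable (\<Pi>\<^sub>M i\<in>{..<N}. borel)" by measurable
  have "(indicator {e::nat \<Rightarrow> complex. \<forall>i\<in>{..<N}. norm (e i) \<le> real N powr (- 3 / 8)} :: _ \<Rightarrow> real) \<in>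
      borel_measurable (\<Pi>\<^sub>M i\<in>{..<N}. borel)"
    by (rule borel_measurable_indicator') measurable
  then have P: "?P \<in> borel_measurable (\<Pi>\<^sub>M i\<in>{..<N}. borel)" by (simp add: Ball_def)
  show "I_sph 1 N M \<theta> = (LINT e|(unif_sphere N :: (nat \<Rightarrow> real) measure). exp (real N * \<theta> * (\<Sum>i<N. d i * (norm (e i))\<^sup>2)))"
    unfolding I integral_sphere_law_1[OF F] by simp
  show "I_sph_deloc 1 N M \<theta> = (LINT e|(unif_sphere N :: (nat \<Rightarrow> real) measure).
      indicator {e. \<forall>i<N. norm (e i) \<le> real N powr (- 3 / 8)} e * exp (real N * \<theta> * (\<Sum>i<N. d i * (norm (e i))\<^sup>2)))"
    unfolding I' integral_sphere_law_1[OF borel_measurable_times[OF P F]]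
    by (simp add: indicator_def)
  show "I_sph 2 N M \<theta> = (LINT e|(unif_sphere N :: (nat \<Rightarrow> complex) measure). exp (real N * \<theta> * (\<Sum>i<N. d i * (norm (e i))\<^sup>2)))"
    unfolding I by (simp add: sphere_law_def)
  show "I_sph_deloc 2 N M \<theta> = (LINT e|(unif_sphere N :: (nat \<Rightarrow> complex) measure).
      indicator {e. \<forall>i<N. norm (e i) \<le> real N powr (- 3 / 8)} e * exp (real N * \<theta> * (\<Sum>i<N. d i * (norm (e i))\<^sup>2)))"
    unfolding I' by (simp add: sphere_law_def)
qed

theorem lemma4p4:
  fixes \<beta> :: nat and D :: "nat \<Rightarrow> complex mat" and \<mu>\<^sub>D :: "real measure" and \<theta> :: real
  assumes "\<beta> \<in> {1, 2}"
    and "\<And>N. N \<ge> 1 \<Longrightarrow> D N \<in> carrier_mat N N"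
    and "\<And>N. N \<ge> 1 \<Longrightarrow> diagonal_mat (D N)"
    and "\<And>N i. N \<ge> 1 \<Longrightarrow> i < N \<Longrightarrow> D N $$ (i, i) \<in> \<real>"
    and "real_distribution \<mu>\<^sub>D"
    and "compact (msupport \<mu>\<^sub>D)"
    and "weak_conv_m (\<lambda>N. emp_measure (D N)) \<mu>\<^sub>D"
    and "(\<lambda>N. eigval (D N) N) \<longlonglongrightarrow> right_end \<mu>\<^sub>D"
    and "(\<lambda>N. eigval (D N) 1) \<longlonglongrightarrow> left_end \<mu>\<^sub>D"
    and "\<exists>C>0. \<exists>\<epsilon>\<^sub>0>0. \<forall>N\<ge>1. BL_dist (emp_measure (D N)) \<mu>\<^sub>D \<le> C * real N powr (- \<epsilon>\<^sub>0)"
    and "0 \<le> \<theta>"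
    and "ereal \<theta> < theta_c \<beta> \<mu>\<^sub>D"
  shows "(\<forall>\<^sub>F N in sequentially. I_sph_deloc \<beta> N (D N) \<theta> / I_sph \<beta> N (D N) \<theta> > 0) \<and>
    (\<lambda>N. 1 / real N * ln (I_sph_deloc \<beta> N (D N) \<theta> / I_sph \<beta> N (D N) \<theta>)) \<longlonglongrightarrow> 0"
proof -
  define d where "d N i = Re (D N $$ (i, i))" for N i
  let ?r = "right_end \<mu>\<^sub>D" and ?l = "left_end \<mu>\<^sub>D"
  have \<beta>: "1 \<le> \<beta>" using assms(1) by auto
  \<comment> \<open>Convergence of the largest eigenvalue excludes outliers: eventually all entries
    lie left of any point beyond the support.\<close>
  have upper: "\<forall>\<^sub>F N in sequentially. \<forall>i<N. d N i \<le> x" if x: "?r < x" for x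
    using order_tendstoD(2)[OF assms(8) x] eventually_ge_at_top[of 1]
  proof eventually_elim
    case (elim N)
    have "d N i \<le> eigval (D N) N" if "i < N" for i
      unfolding d_def using elim(2) that assms(2,3,4) by (intro eigval_diagonal_bounds(2)) auto
    then show ?case using elim(1) by (meson less_imp_le order_trans)
  qed
  have l: "?l - 1 < ?l" by simp
  have lower: "\<forall>\<^sub>F N in sequentially. \<forall>i<N. ?l - 1 \<le> d N i"
    using order_tendstoD(1)[OF assms(9) l] eventually_ge_at_top[of 1]
  proof eventually_elim
    case (elim N)
    have "eigval (D N) 1 \<le> d N i" if "i < N" for i
      unfolding d_def using elim(2) that assms(2,3,4) by (intro eigval_diagonal_bounds(1)) auto
    then show ?case using elim(1) by (meson less_imp_le order_trans)
  qed
  let ?K = "\<bar>?l\<bar> + \<bar>?r\<bar> + 1"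
  have K: "\<forall>\<^sub>F N in sequentially. \<forall>i<N. \<bar>d N i\<bar> \<le> ?K"
    using lower upper[of "?r + 1", simplified] by eventually_elim fastforce
  \<comment> \<open>The choice of the Gaussian law: all its coefficients stay bounded below, and its
    mean squared norm tends to 1.\<close>
  have "\<exists>w c0. 0 < c0 \<and> (\<forall>\<^sub>F N in sequentially. \<forall>i<N. c0 \<le> w - \<theta> * d N i) \<and>
      (\<lambda>N. (\<Sum>i<N. real \<beta> / 2 / (w - \<theta> * d N i)) / real N) \<longlonglongrightarrow> 1"
  proof (cases "\<theta> = 0")
    case True
    have "\<forall>\<^sub>F N in sequentially. 1 = (\<Sum>i<N. real \<beta> / 2 / (real \<beta> / 2 - \<theta> * d N i)) / real N"
      using eventually_ge_at_top[of 1] by eventually_elim (use True \<beta> in auto)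
    then have "(\<lambda>N. (\<Sum>i<N. real \<beta> / 2 / (real \<beta> / 2 - \<theta> * d N i)) / real N) \<longlonglongrightarrow> 1"
      by (rule Lim_transform_eventually[OF tendsto_const])
    \<comment> \<open>The same witness serves for \<open>w\<close> and for \<open>c0\<close>, since
      the coefficients are constant when \<theta> = 0.\<close>
    then show ?thesis using True \<beta> by (intro exI[of _ "real \<beta> / 2"]) auto
  next
    case False
    then have \<theta>: "0 < \<theta>" using assms(11) by simp
    obtain v where v: "?r < v" "real \<beta> / 2 * cauchy_transform \<mu>\<^sub>D v = \<theta>"
      using saddle_point_exists[OF assms(5,6) \<theta> \<beta> assms(12)] .
    \<comment> \<open>The midpoint separates the entries from \<open>v\<close>; the gap
      \<open>v - ?x\<close> times \<theta> becomes the lower bound \<open>c0\<close>.\<close>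
    let ?x = "(?r + v) / 2"
    have x: "?r < ?x" "?x < v" using v by auto
    have "(\<lambda>N. (\<Sum>i<N. 1 / (v - d N i)) / real N) \<longlonglongrightarrow> cauchy_transform \<mu>\<^sub>D v"
    proof (rule emp_mean_tendsto[OF assms(5,6) _ assms(7) _ x upper[OF x(1)]])
      show "(LINT x|emp_measure (D N). f x) = (\<Sum>i<N. f (d N i)) / real N"
        if "1 \<le> N" "f \<in> borel_measurable borel" for N and f :: "real \<Rightarrow> real"
        unfolding d_def using that assms(2,3,4) by (intro integral_emp_measure_diagonal) auto
    qed (use assms(2) real_distribution_emp_measure in auto)
    \<comment> \<open>For \<open>w = \<theta> * v\<close> the mean squared norm is this multiple of
      the empirical Cauchy transform, and the saddle point equation makes its limit 1.\<close>
    then have "(\<lambda>N. real \<beta> / 2 / \<theta> * ((\<Sum>i<N. 1 / (v - d N i)) / real N)) \<longlonglongrightarrow> real \<beta> / 2 / \<theta> * cauchy_transform \<mu>\<^sub>D v"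
      by (rule tendsto_mult_left)
    also have "real \<beta> / 2 / \<theta> * cauchy_transform \<mu>\<^sub>D v = 1"
      using v(2) \<theta> by (simp add: field_simps)
    also have "(\<lambda>N. real \<beta> / 2 / \<theta> * ((\<Sum>i<N. 1 / (v - d N i)) / real N)) =
        (\<lambda>N. (\<Sum>i<N. real \<beta> / 2 / (\<theta> * v - \<theta> * d N i)) / real N)"
      unfolding right_diff_distrib[symmetric] by (simp add: sum_distrib_left mult.assoc)
    finally have mean: "(\<lambda>N. (\<Sum>i<N. real \<beta> / 2 / (\<theta> * v - \<theta> * d N i)) / real N) \<longlonglongrightarrow> 1" .
    have "\<forall>\<^sub>F N in sequentially. \<forall>i<N. \<theta> * (v - ?x) \<le> \<theta> * v - \<theta> * d N i"
      using upper[OF x(1)]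
      by eventually_elim (use \<theta> in \<open>auto simp only: right_diff_distrib[symmetric] intro!: mult_left_mono\<close>)
    then show ?thesis using mean \<theta> x by (intro exI[of _ "\<theta> * v"] exI[of _ "\<theta> * (v - ?x)"]) auto
  qed
  then obtain w c0 where w: "0 < c0" "\<forall>\<^sub>F N in sequentially. \<forall>i<N. c0 \<le> w - \<theta> * d N i"
      "(\<lambda>N. (\<Sum>i<N. real \<beta> / 2 / (w - \<theta> * d N i)) / real N) \<longlonglongrightarrow> 1" by blast
  define a where "a N = I_sph \<beta> N (D N) \<theta>" for N
  define b where "b N = I_sph_deloc \<beta> N (D N) \<theta>" for N
  \<comment> \<open>The existential hides the scalar field: the integrals over the real and the
    complex sphere live on different types, but the conclusion no longer mentions them.\<close>
  have "\<exists>a' b'. (\<forall>N\<ge>1. a N = a' N \<and> b N = b' N) \<and> (\<forall>\<^sub>F N in sequentially. b' N / a' N > 0) \<and>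
      (\<lambda>N. 1 / real N * ln (b' N / a' N)) \<longlonglongrightarrow> 0"
  proof (cases "\<beta> = 1")
    case True
    have "\<forall>N\<ge>1. a N = (LINT e|(unif_sphere N :: (nat \<Rightarrow> real) measure).
          exp (real N * \<theta> * (\<Sum>i<N. d N i * (norm (e i))\<^sup>2))) \<and>
        b N = (LINT e|(unif_sphere N :: (nat \<Rightarrow> real) measure).
          indicator {e. \<forall>i<N. norm (e i) \<le> real N powr (- 3 / 8)} e * exp (real N * \<theta> * (\<Sum>i<N. d N i * (norm (e i))\<^sup>2)))"
    proof (intro allI impI conjI)
      fix N :: nat assume N: "1 \<le> N"
      note M = N assms(2)[OF N] assms(3)[OF N] assms(4)[OF N]
      show "a N = (LINT e|(unif_sphere N :: (nat \<Rightarrow> real) measure).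
          exp (real N * \<theta> * (\<Sum>i<N. d N i * (norm (e i))\<^sup>2)))"
        unfolding a_def d_def True by (rule I_sph_diagonal(1)[OF M])
      show "b N = (LINT e|(unif_sphere N :: (nat \<Rightarrow> real) measure).
          indicator {e. \<forall>i<N. norm (e i) \<le> real N powr (- 3 / 8)} e * exp (real N * \<theta> * (\<Sum>i<N. d N i * (norm (e i))\<^sup>2)))"
        unfolding b_def d_def True by (rule I_sph_diagonal(2)[OF M])
    qed
    moreover have "(\<lambda>N. (\<Sum>i<N. real DIM(real) / 2 / (w - \<theta> * d N i)) / real N) \<longlonglongrightarrow> 1"
      using w(3) True by simp
    note sphere_deloc_limit[where 'a = real, OF assms(11) w(1) K w(2) this]
    ultimately show ?thesis by (intro exI conjI) (assumption | elim conjunct1 conjunct2)+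
  next
    case False
    then have 2: "\<beta> = 2" using assms(1) by auto
    have "\<forall>N\<ge>1. a N = (LINT e|(unif_sphere N :: (nat \<Rightarrow> complex) measure).
          exp (real N * \<theta> * (\<Sum>i<N. d N i * (norm (e i))\<^sup>2))) \<and>
        b N = (LINT e|(unif_sphere N :: (nat \<Rightarrow> complex) measure).
          indicator {e. \<forall>i<N. norm (e i) \<le> real N powr (- 3 / 8)} e * exp (real N * \<theta> * (\<Sum>i<N. d N i * (norm (e i))\<^sup>2)))"
    proof (intro allI impI conjI)
      fix N :: nat assume N: "1 \<le> N"
      note M = N assms(2)[OF N] assms(3)[OF N] assms(4)[OF N]
      show "a N = (LINT e|(unif_sphere N :: (nat \<Rightarrow> complex) measure).
          exp (real N * \<theta> * (\<Sum>i<N. d N i * (norm (e i))\<^sup>2)))"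
        unfolding a_def d_def 2 by (rule I_sph_diagonal(3)[OF M])
      show "b N = (LINT e|(unif_sphere N :: (nat \<Rightarrow> complex) measure).
          indicator {e. \<forall>i<N. norm (e i) \<le> real N powr (- 3 / 8)} e * exp (real N * \<theta> * (\<Sum>i<N. d N i * (norm (e i))\<^sup>2)))"
        unfolding b_def d_def 2 by (rule I_sph_diagonal(4)[OF M])
    qed
    moreover have "(\<lambda>N. (\<Sum>i<N. real DIM(complex) / 2 / (w - \<theta> * d N i)) / real N) \<longlonglongrightarrow> 1"
      using w(3) 2 by simp
    note sphere_deloc_limit[where 'a = complex, OF assms(11) w(1) K w(2) this]
    ultimately show ?thesis by (intro exI conjI) (assumption | elim conjunct1 conjunct2)+
  qed
  then obtain a' b' where eq: "\<forall>N\<ge>1. a N = a' N \<and> b N = b' N" and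
    lim: "\<forall>\<^sub>F N in sequentially. b' N / a' N > 0" "(\<lambda>N. 1 / real N * ln (b' N / a' N)) \<longlonglongrightarrow> 0" by blast
  have ev: "\<forall>\<^sub>F N in sequentially. a' N = a N \<and> b' N = b N"
    using eventually_ge_at_top[of 1] by eventually_elim (use eq in auto)
  have "\<forall>\<^sub>F N in sequentially. b N / a N > 0" using lim(1) ev by eventually_elim auto
  moreover have "(\<lambda>N. 1 / real N * ln (b N / a N)) \<longlonglongrightarrow> 0"
    by (rule Lim_transform_eventually[OF lim(2)]) (use ev in eventually_elim, auto)
  ultimately show ?thesis unfolding a_def b_def by blast
qed

end
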